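(* Let $\mu\in(0,\infty)$ be a fixed number and let $T\sim F_T$, $A\sim F_A$, $B\sim F_B$ be nonnegative random variables. Then $$0\le \mathsf{E}[T]<1,\quad \mathsf{E}[A]=1,\quad \mathsf{E}[A^2]<\infty\quad\text{and}\quad 0\le \mathsf{E}[B]<\infty$$ if and only if the functional equation $$\hat F(s)=\int_0^\infty\{\exp(-\sigma_B(\sigma(s)))\}^a\,\mathrm{d}F_A(a),\quad s\ge 0,$$ has exactly one solution $X\sim F$ (a distribution $F$ of a nonnegative random variable $X$) with mean $\mu$ and finite variance. Moreover, in this case, $$\mathsf{Var}[X]=\frac{\mathsf{Var}[A]+\mathsf{E}[B]+\mathsf{E}[T]}{1-\mathsf{E}[T]}\,\mu^2 .$$
   Context: For a nonnegative random variable $Y$, $Y\sim F_Y$ means that $Y$ has distribution function $F_Y$, and $\hat F_Y(s)=\mathsf{E}[e^{-sY}]=\int_0^\infty e^{-sy}\,\mathrm{d}F_Y(y)$, $s\ge0$, is its Laplace–Stieltjes transform. Integrals $\int_0^\infty$ with respect to distributions include a possible atom at $0$. For a distribution $F$ on $[0,\infty)$ with mean $\mu\in(0,\infty)$ (the unknown of the equation), define $$\sigma(s)=\int_0^\infty\frac{1-\hat F(ts)}{t}\,\mathrm{d}F_T(t),\quad s\ge0,$$ where the integrand at $t=0$ is defined by continuity to be $\mu s$. Equivalently, $\sigma(s)=\mu\int_0^s\hat F_{TZ}(x)\,\mathrm{d}x$, where $Z$ is independent of $T$ and has the length-biased distribution $F_Z(z)=\frac1\mu\int_0^z x\,\mathrm{d}F(x)$,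 $z\ge0$. Note that $\sigma$ depends on the unknown $F$. Define also $\sigma_B(s)=\int_0^s\hat F_B(t)\,\mathrm{d}t$, $s\ge0$. *)

theory Defs
  imports "HOL-Probability.Probability"
begin

text \<open>
  A distribution is represented by its law, a probability measure on the Borel sets of the reals;
  it is the distribution of a nonnegative random variable if it is concentrated on the interval
  from 0 to infinity.  Integrals with respect to such a law over the whole real line
  thus are integrals over that interval, including a possible atom at 0.
\<close>

definition nonneg_distribution :: "real measure \<Rightarrow> bool" where
  "nonneg_distribution D \<longleftrightarrow> real_distribution D \<and> (AE x in D. 0 \<le> x)"

text \<open>
  A Bochner integral is 0 when it diverges, so finiteness of a mean is the separate condition
  of integrability of the identity.
\<close>

abbreviation mean_finite :: "real measure \<Rightarrow> bool" where
  "mean_finite D \<equiv> integrable D (\<lambda>x. x)"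

abbreviation mean :: "real measure \<Rightarrow> real" where
  "mean D \<equiv> prob_space.expectation D (\<lambda>x. x)"

abbreviation var_finite :: "real measure \<Rightarrow> bool" where
  "var_finite D \<equiv> mean_finite D \<and> integrable D (\<lambda>x. (x - mean D)\<^sup>2)"

abbreviation var :: "real measure \<Rightarrow> real" where
  "var D \<equiv> prob_space.variance D (\<lambda>x. x)"

definition laplace_stieltjes :: "real measure \<Rightarrow> real \<Rightarrow> real" where
  "laplace_stieltjes D s = (LINT y|D. exp (- s * y))"

text \<open>At \<open>t = 0\<close> the integrand is the limit of the difference quotient.\<close>

definition sigma_T :: "real measure \<Rightarrow> real measure \<Rightarrow> real \<Rightarrow> real" where
  "sigma_T FT F s =
     (LINT t|FT. (if t = 0 then mean F * s else (1 - laplace_stieltjes F (t * s)) / t))"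

definition sigma_B :: "real measure \<Rightarrow> real \<Rightarrow> real" where
  "sigma_B FB s = (LBINT t:{0..s}. laplace_stieltjes FB t)"

definition solves_equation ::
    "real measure \<Rightarrow> real measure \<Rightarrow> real measure \<Rightarrow> real measure \<Rightarrow> bool" where
  "solves_equation FT FA FB F \<longleftrightarrow>
     (\<forall>s\<ge>0. laplace_stieltjes F s =
        (LINT a|FA. exp (- sigma_B FB (sigma_T FT F s)) powr a))"

definition solution_with_mean ::
    "real measure \<Rightarrow> real measure \<Rightarrow> real measure \<Rightarrow> real \<Rightarrow> real measure \<Rightarrow> bool" where
  "solution_with_mean FT FA FB \<mu> F \<longleftrightarrow>
     nonneg_distribution F \<and> var_finite F \<and> mean F = \<mu> \<and> solves_equation FT FA FB F"

end

theory Submission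
  imports Defs "HOL-Real_Asymp.Real_Asymp"
begin

text \<open>
  Write \<open>L D\<close> for the Laplace--Stieltjes transform of a distribution \<open>D\<close>, write \<open>\<sigma>\<close> for
  \<^const>\<open>sigma_T\<close> and let \<open>u = \<sigma>\<^sub>B \<circ> \<sigma>\<close>, so that \<open>u\<close> depends on the unknown \<open>F\<close>.  The equation is
  \<open>L F = L FA \<circ> u\<close>.  Everything is read off from expansions at \<open>0\<close> up to order \<open>s\<^sup>2\<close>: a distribution
  with mean \<open>m\<close> has \<open>L D s = 1 - m s + s\<^sup>2 R(s)\<close>, where \<open>R \<ge> 0\<close> and \<open>R(s)\<close> tends to half the
  second moment if that is finite, and conversely boundedness of \<open>R\<close> near \<open>0\<close> forces a finite second moment
  (Fatou).  The same holds for the difference quotient and the mean.  Fubini gives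
  \<open>\<sigma>\<^sub>B = \<sigma>\<close> for the pair \<open>FB\<close>, \<open>\<delta>\<^sub>1\<close> (\<open>sigma_B_eq_sigma_T\<close>), so one analysis serves both maps.

  Necessity and the variance.  For a solution \<open>F\<close> with mean \<open>\<mu>\<close>, first order terms give
  \<open>E[A] = 1\<close>.  Then
  \<open>s\<^sup>2 R\<^sub>F(s) = (\<mu> s - \<sigma>(s)) + (\<sigma>(s) - \<sigma>\<^sub>B(\<sigma>(s))) + u(s)\<^sup>2 R\<^sub>A(u(s))\<close>,
  with three nonnegative summands.  Dividing by \<open>s\<^sup>2\<close>, boundedness of the left side makes \<open>E[T]\<close>,
  \<open>E[B]\<close> and \<open>E[A\<^sup>2]\<close> finite (\<open>moments_of_solution\<close>), and the limit is
  \<open>E[X\<^sup>2] = E[T] E[X\<^sup>2] + \<mu>\<^sup>2 E[B] + \<mu>\<^sup>2 E[A\<^sup>2]\<close> (\<open>second_moment_equation\<close>).  Since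
  \<open>E[A\<^sup>2] \<ge> E[A]\<^sup>2 = 1\<close>, this forces \<open>E[T] < 1\<close>; solving for \<open>E[X\<^sup>2]\<close> gives the variance.

  Uniqueness.  Two distributions with the same mean and finite second moments have transforms that
  differ by at most \<open>K s\<^sup>2\<close>.  The map \<open>F \<mapsto> L FA \<circ> u\<close> multiplies the constant \<open>K\<close> by
  at most \<open>E[T]\<close> (\<open>exponent_contraction\<close>), so for \<open>E[T] < 1\<close> the transforms of two solutions
  agree, and the transform determines the distribution (\<open>laplace_stieltjes_unique\<close>).

  Existence.  The same contraction makes the iteration started at \<open>\<delta>\<^sub>\<mu>\<close> converge, and the limit is
  a transform by the continuity theorem (\<open>laplace_continuity_theorem\<close>).  The point is that
  \<open>L FA \<circ> u\<close> is again the transform of a distribution (\<open>solution_operator\<close>).  This holds because \<open>\<sigma>\<close> and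
  \<open>\<sigma>\<^sub>B\<close> are Laplace exponents of infinitely divisible distributions: \<open>\<sigma>\<close> is a mixture of the
  compound Poisson exponents \<open>(1 - L F (t s)) / t\<close>.
\<close>

section \<open>Integration lemmas\<close>

lemma integral_dominated_convergence_at_right:
  fixes h :: "real \<Rightarrow> 'a \<Rightarrow> real"
  assumes "f \<in> borel_measurable M" "\<And>s. 0 < s \<Longrightarrow> h s \<in> borel_measurable M" "integrable M w"
    and lim: "AE x in M. ((\<lambda>s. h s x) \<longlongrightarrow> f x) (at_right 0)"
    and bound: "\<And>s. 0 < s \<Longrightarrow> AE x in M. \<bar>h s x\<bar> \<le> w x"
  shows "((\<lambda>s. \<integral>x. h s x \<partial>M) \<longlongrightarrow> (\<integral>x. f x \<partial>M)) (at_right 0)"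
  unfolding tendsto_at_iff_sequentially comp_def
proof (intro allI impI)
  fix X :: "nat \<Rightarrow> real" assume X: "\<forall>i. X i \<in> {0<..} - {0}" "X \<longlonglongrightarrow> 0"
  show "(\<lambda>i. \<integral>x. h (X i) x \<partial>M) \<longlonglongrightarrow> (\<integral>x. f x \<partial>M)"
  proof (rule integral_dominated_convergence[where w = w])
    show "AE x in M. (\<lambda>i. h (X i) x) \<longlonglongrightarrow> f x"
      using lim
    proof eventually_elim
      case (elim x)
      then show ?case using X unfolding tendsto_at_iff_sequentially comp_def by blast
    qed
  qed (use assms X in auto)
qed

text \<open>
  Fatou's lemma in the form that turns bounds on difference quotients into finite moments.
\<close>

lemma integrable_limit_of_bounded_integrals:
  fixes f :: "nat \<Rightarrow> 'a \<Rightarrow> real"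
  assumes [measurable]: "u \<in> borel_measurable M"
    and int: "\<And>n. integrable M (f n)"
    and nonneg: "\<And>n. AE x in M. 0 \<le> f n x"
    and lim: "AE x in M. (\<lambda>n. f n x) \<longlonglongrightarrow> u x"
    and bound: "\<And>n. (\<integral>x. f n x \<partial>M) \<le> K"
  shows "integrable M u"
proof -
  have [measurable]: "f n \<in> borel_measurable M" for n
    using int by auto
  have nonneg': "AE x in M. \<forall>n. 0 \<le> f n x"
    using nonneg by (simp add: AE_all_countable)
  have u0: "AE x in M. 0 \<le> u x"
    using nonneg' lim by eventually_elim (auto intro: LIMSEQ_le_const)
  have "(\<integral>\<^sup>+x. ennreal (u x) \<partial>M) = (\<integral>\<^sup>+x. liminf (\<lambda>n. ennreal (f n x)) \<partial>M)"
  proof (rule nn_integral_cong_AE)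
    show "AE x in M. ennreal (u x) = liminf (\<lambda>n. ennreal (f n x))"
      using lim
      by eventually_elim (intro lim_imp_Liminf[symmetric] tendsto_ennrealI; simp)
  qed
  also have "\<dots> \<le> liminf (\<lambda>n. \<integral>\<^sup>+x. ennreal (f n x) \<partial>M)"
    by (rule nn_integral_liminf) measurable
  also have "\<dots> \<le> liminf (\<lambda>n. ennreal K)"
  proof (rule Liminf_mono, rule always_eventually, rule allI)
    fix n
    have "(\<integral>\<^sup>+x. ennreal (f n x) \<partial>M) = ennreal (\<integral>x. f n x \<partial>M)"
      by (rule nn_integral_eq_integral[OF int nonneg])
    then show "(\<integral>\<^sup>+x. ennreal (f n x) \<partial>M) \<le> ennreal K"
      using bound by (simp add: ennreal_leI)
  qed
  also have "\<dots> < \<infinity>"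
    by (simp add: Liminf_const)
  finally show ?thesis
    using u0 by (intro integrableI_nonneg) auto
qed

lemma exp_minus_le_quadratic:
  fixes x :: real
  assumes "0 \<le> x"
  shows "exp (- x) - 1 + x \<le> x\<^sup>2 / 2"
proof -
  have "exp (- x) \<le> 1 - x + x\<^sup>2 / 2"
  proof -
    have "\<exists>t. \<bar>t\<bar> \<le> \<bar>-x\<bar> \<and> exp (-x) = (\<Sum>m<3. (-x) ^ m / fact m) + exp t / fact 3 * (-x) ^ 3"
      by (rule Maclaurin_exp_le)
    then obtain t where "exp (-x) = (\<Sum>m<3. (-x) ^ m / fact m) + exp t / fact 3 * (-x) ^ 3"
      by blast
    moreover have "exp t / fact 3 * (-x) ^ 3 \<le> 0"
      using assms by (simp add: mult_nonneg_nonneg)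
    ultimately show ?thesis
      by (simp add: numeral_3_eq_3 power2_eq_square)
  qed
  then show ?thesis by simp
qed

lemma abs_exp_minus_diff_le:
  fixes x y :: real
  assumes "0 \<le> x" "0 \<le> y"
  shows "\<bar>exp (- x) - exp (- y)\<bar> \<le> \<bar>x - y\<bar>"
proof -
  have *: "\<bar>exp (- a) - exp (- b)\<bar> \<le> \<bar>a - b\<bar>" if "0 \<le> a" "a \<le> b" for a b :: real
  proof -
    have "exp (-a) - exp (-b) = exp (-a) * (1 - exp (-(b - a)))"
      by (simp add: algebra_simps flip: exp_add)
    also have "\<dots> \<le> 1 * (b - a)"
    proof (rule mult_mono)
      show "1 - exp (- (b - a)) \<le> b - a"
        using exp_ge_add_one_self[of "- (b - a)"] by linarith
    qed (use that in auto)
    finally have "exp (-a) - exp (-b) \<le> b - a" by simp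
    moreover have "exp (-b) \<le> exp (-a)" using that by simp
    ultimately show ?thesis using that by linarith
  qed
  show ?thesis
    using *[OF assms(1)] *[OF assms(2)] by (metis abs_minus_commute linear)
qed

section \<open>Distributions on the nonnegative half-line and their transforms\<close>

lemma nonneg_distributionD:
  assumes "nonneg_distribution D"
  shows "real_distribution D" "prob_space D" "sets D = sets borel" "space D = UNIV"
    "AE x in D. 0 \<le> x" "sigma_finite_measure D"
proof -
  show "real_distribution D" "AE x in D. 0 \<le> x"
    using assms by (auto simp: nonneg_distribution_def)
  then interpret real_distribution D by simp
  show "prob_space D" "sets D = sets borel" "space D = UNIV" "sigma_finite_measure D"
    by (auto intro: prob_space_axioms sigma_finite_measure_axioms)
qed

lemma nonneg_distribution_measurable:
  assumes "nonneg_distribution D" "f \<in> borel_measurable borel"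
  shows "f \<in> borel_measurable D"
  using assms nonneg_distributionD(3) measurable_cong_sets by blast

lemma nonneg_distribution_integrable_bounded:
  fixes f :: "real \<Rightarrow> real"
  assumes D: "nonneg_distribution D" and f: "f \<in> borel_measurable borel"
    and B: "\<And>x. 0 \<le> x \<Longrightarrow> \<bar>f x\<bar> \<le> B"
  shows "integrable D f"
proof -
  interpret prob_space D by (rule nonneg_distributionD[OF D])
  show ?thesis
  proof (rule integrable_const_bound[where B = B])
    show "AE x in D. norm (f x) \<le> B"
      using nonneg_distributionD(5)[OF D] by eventually_elim (simp add: B)
  qed (rule nonneg_distribution_measurable[OF D f])
qed

lemma nonneg_distribution_integral_mono:
  fixes f g :: "real \<Rightarrow> real"
  assumes D: "nonneg_distribution D" and "integrable D f" "integrable D g"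
    and le: "\<And>x. 0 \<le> x \<Longrightarrow> f x \<le> g x"
  shows "(\<integral>x. f x \<partial>D) \<le> (\<integral>x. g x \<partial>D)"
proof (rule integral_mono_AE)
  show "AE x in D. f x \<le> g x"
    using nonneg_distributionD(5)[OF D] by eventually_elim (simp add: le)
qed fact+

lemma nonneg_distribution_integral_le_const:
  fixes f :: "real \<Rightarrow> real"
  assumes D: "nonneg_distribution D" and f: "integrable D f"
    and le: "\<And>x. 0 \<le> x \<Longrightarrow> f x \<le> c"
  shows "(\<integral>x. f x \<partial>D) \<le> c"
proof -
  interpret prob_space D by (rule nonneg_distributionD[OF D])
  have "(\<integral>x. f x \<partial>D) \<le> (\<integral>x. c \<partial>D)"
    by (rule nonneg_distribution_integral_mono[OF D f]) (auto simp: le)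
  then show ?thesis by (simp add: prob_space)
qed

lemma nonneg_distribution_integral_nonneg:
  fixes f :: "real \<Rightarrow> real"
  assumes D: "nonneg_distribution D" 
    and ge: "\<And>x. 0 \<le> x \<Longrightarrow> 0 \<le> f x"
  shows "0 \<le> (\<integral>x. f x \<partial>D)"
proof (rule integral_nonneg_AE)
  show "AE x in D. 0 \<le> f x"
    using nonneg_distributionD(5)[OF D] by eventually_elim (simp add: ge)
qed

lemma nonneg_distribution_return:
  "0 \<le> c \<Longrightarrow> nonneg_distribution (return borel c)"
  by (auto simp: nonneg_distribution_def real_distribution_def real_distribution_axioms_def 
      AE_return prob_space_return)

lemma laplace_integrable:
  assumes "nonneg_distribution D" "0 \<le> s"
  shows "integrable D (\<lambda>y. exp (- s * y))"
  by (rule nonneg_distribution_integrable_bounded[where B = 1]) (use assms in auto)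

lemma laplace_nonneg:
  shows "0 \<le> laplace_stieltjes D s"
  unfolding laplace_stieltjes_def by simp

lemma laplace_le_1:
  assumes "nonneg_distribution D" "0 \<le> s"
  shows "laplace_stieltjes D s \<le> 1"
  unfolding laplace_stieltjes_def
  by (rule nonneg_distribution_integral_le_const[OF assms(1) laplace_integrable[OF assms]])
     (use assms in simp)

lemma laplace_return: "laplace_stieltjes (return borel c) s = exp (- s * c)"
  by (simp add: laplace_stieltjes_def integral_return)

lemma integrable_return_borel:
  fixes f :: "real \<Rightarrow> real"
  assumes "f \<in> borel_measurable borel"
  shows "integrable (return borel c) f"
proof -
  interpret prob_space "return borel c" by (simp add: prob_space_return)
  show ?thesis
    by (rule integrable_const_bound[where B = "\<bar>f c\<bar>"]) (use assms in \<open>auto simp: AE_return\<close>)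
qed

lemma return_moments: "mean (return borel c) = (c::real)" "mean_finite (return borel c)"
  "integrable (return borel c) (\<lambda>x. x\<^sup>2)" "(\<integral>x. x\<^sup>2 \<partial>return borel c) = c\<^sup>2"
  by (simp_all add: integral_return integrable_return_borel)

lemma mean_nonneg:
  assumes "nonneg_distribution D" 
  shows "0 \<le> mean D"
  by (rule nonneg_distribution_integral_nonneg[OF assms])

lemma laplace_lipschitz:
  assumes D: "nonneg_distribution D" "mean_finite D" and xy: "0 \<le> x" "0 \<le> y"
  shows "\<bar>laplace_stieltjes D x - laplace_stieltjes D y\<bar> \<le> mean D * \<bar>x - y\<bar>"
proof -
  have "\<bar>laplace_stieltjes D x - laplace_stieltjes D y\<bar>
      = \<bar>\<integral>t. exp (- x * t) - exp (- y * t) \<partial>D\<bar>"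
    using laplace_integrable[OF D(1)] xy by (simp add: laplace_stieltjes_def)
  also have "\<dots> \<le> (\<integral>t. \<bar>exp (- x * t) - exp (- y * t)\<bar> \<partial>D)"
    by (rule integral_abs_bound)
  also have "\<dots> \<le> (\<integral>t. \<bar>x - y\<bar> * t \<partial>D)"
  proof (rule nonneg_distribution_integral_mono[OF D(1)])
    show "integrable D (\<lambda>t. \<bar>exp (- x * t) - exp (- y * t)\<bar>)"
      by (intro integrable_abs Bochner_Integration.integrable_diff laplace_integrable D xy)
    show "integrable D (\<lambda>t. \<bar>x - y\<bar> * t)" using D by simp
    show "\<bar>exp (- x * t) - exp (- y * t)\<bar> \<le> \<bar>x - y\<bar> * t" if "0 \<le> t" for t
      using abs_exp_minus_diff_le[of "x * t" "y * t"] xy that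
      by (simp add: abs_mult flip: left_diff_distrib)
  qed
  finally show ?thesis by (simp add: mult.commute)
qed

lemma laplace_0: "nonneg_distribution D \<Longrightarrow> laplace_stieltjes D 0 = 1"
  using prob_space.prob_space[OF nonneg_distributionD(2)] by (simp add: laplace_stieltjes_def)

lemma one_minus_laplace_le:
  assumes "nonneg_distribution D" "mean_finite D" "0 \<le> s"
  shows "1 - laplace_stieltjes D s \<le> mean D * s"
  using laplace_lipschitz[OF assms(1,2), of s 0] assms laplace_0[OF assms(1)] by simp

lemma laplace_tendsto_1:
  assumes D: "nonneg_distribution D"
  shows "(laplace_stieltjes D \<longlongrightarrow> 1) (at_right 0)"
proof -
  interpret prob_space D by (rule nonneg_distributionD[OF D])
  have "((\<lambda>s. \<integral>y. exp (- s * y) \<partial>D) \<longlongrightarrow> (\<integral>y. 1 \<partial>D)) (at_right 0)"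
  proof (rule integral_dominated_convergence_at_right[where w = "\<lambda>_. 1"])
    show "AE y in D. ((\<lambda>s. exp (- s * y)) \<longlongrightarrow> 1) (at_right 0)"
      by (intro AE_I2, rule tendsto_eq_rhs, (rule tendsto_intros)+) simp
    show "AE y in D. \<bar>exp (- s * y)\<bar> \<le> 1" if "0 < s" for s
      using nonneg_distributionD(5)[OF D] by eventually_elim (use that in simp)
  qed (auto intro!: nonneg_distribution_measurable[OF D])
  then show ?thesis by (simp add: laplace_stieltjes_def[abs_def] prob_space)
qed

section \<open>Moments and the behaviour of the transform at 0\<close>

lemma laplace_first_order_integral:
  assumes "nonneg_distribution D" "0 < s"
  shows "(1 - laplace_stieltjes D s) / s = (\<integral>x. (1 - exp (- s * x)) / s \<partial>D)"
    "integrable D (\<lambda>x. (1 - exp (- s * x)) / s)"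
proof -
  interpret prob_space D by (rule nonneg_distributionD[OF assms(1)])
  show "(1 - laplace_stieltjes D s) / s = (\<integral>x. (1 - exp (- s * x)) / s \<partial>D)"
    using laplace_integrable[OF assms(1), of s] assms(2)
    by (simp add: laplace_stieltjes_def prob_space)
  show "integrable D (\<lambda>x. (1 - exp (- s * x)) / s)"
    using laplace_integrable[OF assms(1), of s] assms(2) by simp
qed

lemma laplace_first_order_limit:
  assumes D: "nonneg_distribution D" "mean_finite D"
  shows "((\<lambda>s. (1 - laplace_stieltjes D s) / s) \<longlongrightarrow> mean D) (at_right 0)"
proof -
  have "((\<lambda>s. \<integral>x. (1 - exp (- s * x)) / s \<partial>D) \<longlongrightarrow> mean D) (at_right 0)"
  proof (rule integral_dominated_convergence_at_right[where w = "\<lambda>x. x"])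
    show "AE x in D. ((\<lambda>s. (1 - exp (- s * x)) / s) \<longlongrightarrow> x) (at_right 0)"
      by (intro AE_I2) real_asymp
    show "AE x in D. \<bar>(1 - exp (- s * x)) / s\<bar> \<le> x" if "0 < s" for s
      using nonneg_distributionD(5)[OF D(1)]
    proof eventually_elim
      case (elim x)
      have "1 - exp (- s * x) \<le> s * x" 
        using exp_ge_add_one_self[of "- s * x"] by linarith
      then show ?case using elim that by (simp add: field_simps)
    qed
  qed (auto intro!: nonneg_distribution_measurable[OF D(1)] D)
  moreover have "eventually (\<lambda>s. (\<integral>x. (1 - exp (- s * x)) / s \<partial>D) = (1 - laplace_stieltjes D s) / s)
      (at_right 0)"
    using eventually_at_right_less[of 0]
    by eventually_elim (rule laplace_first_order_integral(1)[OF D(1), symmetric])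
  ultimately show ?thesis by (rule Lim_transform_eventually)
qed

text \<open>
  The integrands \<open>(1 - exp (- s x)) / s\<close> are nonnegative and tend to \<open>x\<close>, so Fatou's lemma bounds
  the mean.  A single null sequence of arguments suffices, so that the sequence can be the image of
  another one under \<open>u\<close>.
\<close>

lemma mean_finite_if_bounded_difference_quotients:
  assumes D: "nonneg_distribution D"
    and u: "\<And>n. 0 < u n" "u \<longlonglongrightarrow> 0"
    and K: "\<And>n. (1 - laplace_stieltjes D (u n)) / u n \<le> K"
  shows "mean_finite D"
proof (rule integrable_limit_of_bounded_integrals)
  show "integrable D (\<lambda>x. (1 - exp (- u n * x)) / u n)" for n
    by (rule laplace_first_order_integral[OF D u(1)])
  show "AE x in D. 0 \<le> (1 - exp (- u n * x)) / u n" for n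
    using nonneg_distributionD(5)[OF D] by eventually_elim (use u(1)[of n] in simp)
  show "AE x in D. (\<lambda>n. (1 - exp (- u n * x)) / u n) \<longlonglongrightarrow> x"
  proof (rule AE_I2)
    fix x :: real
    have "((\<lambda>s. (1 - exp (- s * x)) / s) \<longlongrightarrow> x) (at_right 0)" by real_asymp
    moreover have "filterlim u (at_right 0) sequentially"
      using u by (auto simp: filterlim_at order_less_imp_not_eq2)
    ultimately show "(\<lambda>n. (1 - exp (- u n * x)) / u n) \<longlonglongrightarrow> x"
      by (rule filterlim_compose)
  qed
  show "(\<integral>x. (1 - exp (- u n * x)) / u n \<partial>D) \<le> K" for n
    using K[of n] by (simp add: laplace_first_order_integral(1)[OF D u(1)])
qed (auto intro!: nonneg_distribution_measurable[OF D])

text \<open>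
  The coefficient \<open>R\<close> of \<open>s\<^sup>2\<close> in \<open>L D s = 1 - m s + s\<^sup>2 R(s)\<close>.
\<close>

definition laplace_remainder :: "real measure \<Rightarrow> real \<Rightarrow> real" where
  "laplace_remainder D s = (laplace_stieltjes D s - 1 + mean D * s) / s\<^sup>2"

lemma laplace_expansion:
  "s \<noteq> 0 \<Longrightarrow> laplace_stieltjes D s = 1 - mean D * s + s\<^sup>2 * laplace_remainder D s"
  by (simp add: laplace_remainder_def)

lemma laplace_remainder_integral:
  assumes "nonneg_distribution D" "mean_finite D" "0 < s"
  shows "laplace_remainder D s = (\<integral>x. (exp (- s * x) - 1 + s * x) / s\<^sup>2 \<partial>D)"
    "integrable D (\<lambda>x. (exp (- s * x) - 1 + s * x) / s\<^sup>2)"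
proof -
  interpret prob_space D by (rule nonneg_distributionD[OF assms(1)])
  show "laplace_remainder D s = (\<integral>x. (exp (- s * x) - 1 + s * x) / s\<^sup>2 \<partial>D)"
    using laplace_integrable[OF assms(1), of s] assms(2,3)
    by (simp add: laplace_remainder_def laplace_stieltjes_def prob_space mult.commute)
  show "integrable D (\<lambda>x. (exp (- s * x) - 1 + s * x) / s\<^sup>2)"
    using laplace_integrable[OF assms(1), of s] assms(2,3) by simp
qed

lemma second_order_kernel_bounds:
  fixes x s :: real
  assumes "0 \<le> x" "0 < s"
  shows "0 \<le> (exp (- s * x) - 1 + s * x) / s\<^sup>2" "(exp (- s * x) - 1 + s * x) / s\<^sup>2 \<le> x\<^sup>2 / 2"
proof -
  have "0 \<le> exp (- s * x) - 1 + s * x"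
    using exp_ge_add_one_self[of "- s * x"] by linarith
  then show "0 \<le> (exp (- s * x) - 1 + s * x) / s\<^sup>2" by simp
  show "(exp (- s * x) - 1 + s * x) / s\<^sup>2 \<le> x\<^sup>2 / 2"
    using exp_minus_le_quadratic[of "s * x"] assms by (simp add: field_simps power_mult_distrib)
qed

lemma second_order_kernel_limit:
  fixes x :: real
  shows "((\<lambda>s. (exp (- s * x) - 1 + s * x) / s\<^sup>2) \<longlongrightarrow> x\<^sup>2 / 2) (at_right 0)"
proof -
  have "((\<lambda>s. (exp (- s * x) - 1 + s * x) / s\<^sup>2) \<longlongrightarrow> x * x / 2) (at_right 0)"
    by real_asymp
  then show ?thesis by (simp add: power2_eq_square)
qed

lemma laplace_remainder_nonneg:
  assumes "nonneg_distribution D" "mean_finite D" "0 < s"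
  shows "0 \<le> laplace_remainder D s"
  unfolding laplace_remainder_integral(1)[OF assms]
  by (rule nonneg_distribution_integral_nonneg[OF assms(1)])
     (use second_order_kernel_bounds assms in blast)

lemma laplace_remainder_le:
  assumes D: "nonneg_distribution D" "mean_finite D" "integrable D (\<lambda>x. x\<^sup>2)" "0 < s"
  shows "laplace_remainder D s \<le> (\<integral>x. x\<^sup>2 \<partial>D) / 2"
proof -
  have "laplace_remainder D s \<le> (\<integral>x. x\<^sup>2 / 2 \<partial>D)"
    unfolding laplace_remainder_integral(1)[OF D(1,2,4)]
    by (rule nonneg_distribution_integral_mono[OF D(1) laplace_remainder_integral(2)[OF D(1,2,4)]])
       (use second_order_kernel_bounds D in auto)
  then show ?thesis using D by simp
qed

lemma laplace_remainder_limit: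
  assumes D: "nonneg_distribution D" "mean_finite D" "integrable D (\<lambda>x. x\<^sup>2)"
  shows "(laplace_remainder D \<longlongrightarrow> (\<integral>x. x\<^sup>2 \<partial>D) / 2) (at_right 0)"
proof -
  have "((\<lambda>s. \<integral>x. (exp (- s * x) - 1 + s * x) / s\<^sup>2 \<partial>D) \<longlongrightarrow> (\<integral>x. x\<^sup>2 / 2 \<partial>D)) (at_right 0)"
  proof (rule integral_dominated_convergence_at_right[where w = "\<lambda>x. x\<^sup>2 / 2"])
    show "AE x in D. ((\<lambda>s. (exp (- s * x) - 1 + s * x) / s\<^sup>2) \<longlongrightarrow> x\<^sup>2 / 2) (at_right 0)"
      by (intro AE_I2 second_order_kernel_limit)
    show "AE x in D. \<bar>(exp (- s * x) - 1 + s * x) / s\<^sup>2\<bar> \<le> x\<^sup>2 / 2" if "0 < s" for s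
      using nonneg_distributionD(5)[OF D(1)]
    proof eventually_elim
      case (elim x)
      show ?case unfolding abs_of_nonneg[OF second_order_kernel_bounds(1)[OF elim that]]
        by (rule second_order_kernel_bounds(2)[OF elim that])
    qed
      show "integrable D (\<lambda>x. x\<^sup>2 / 2)" using D(3) by simp
  qed (rule nonneg_distribution_measurable[OF D(1)]; measurable)+
  moreover have "eventually (\<lambda>s. (\<integral>x. (exp (- s * x) - 1 + s * x) / s\<^sup>2 \<partial>D) = laplace_remainder D s)
      (at_right 0)"
    using eventually_at_right_less[of 0]
    by eventually_elim (rule laplace_remainder_integral(1)[OF D(1,2), symmetric])
  ultimately have "(laplace_remainder D \<longlongrightarrow> (\<integral>x. x\<^sup>2 / 2 \<partial>D)) (at_right 0)"
    by (rule Lim_transform_eventually)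
  then show ?thesis using D by simp
qed

text \<open>
  The second order analogue, again by Fatou's lemma: the integrand of the remainder
  is nonnegative and tends to \<open>x\<^sup>2 / 2\<close>.
\<close>

lemma second_moment_finite_if_bounded_remainders:
  assumes D: "nonneg_distribution D" "mean_finite D"
    and u: "\<And>n. 0 < u n" "u \<longlonglongrightarrow> 0"
    and K: "\<And>n. laplace_remainder D (u n) \<le> K"
  shows "integrable D (\<lambda>x. x\<^sup>2)"
proof -
  have "integrable D (\<lambda>x. x\<^sup>2 / 2)"
  proof (rule integrable_limit_of_bounded_integrals)
    show "integrable D (\<lambda>x. (exp (- u n * x) - 1 + u n * x) / (u n)\<^sup>2)" for n
      by (rule laplace_remainder_integral[OF D u(1)])
    show "AE x in D. 0 \<le> (exp (- u n * x) - 1 + u n * x) / (u n)\<^sup>2" for n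
      using nonneg_distributionD(5)[OF D(1)]
      by eventually_elim (use u(1)[of n] second_order_kernel_bounds in blast)
    show "AE x in D. (\<lambda>n. (exp (- u n * x) - 1 + u n * x) / (u n)\<^sup>2) \<longlonglongrightarrow> x\<^sup>2 / 2"
    proof (rule AE_I2)
      fix x :: real
      have "((\<lambda>s. (exp (- s * x) - 1 + s * x) / s\<^sup>2) \<longlongrightarrow> x\<^sup>2 / 2) (at_right 0)" by (rule second_order_kernel_limit)
      moreover have "filterlim u (at_right 0) sequentially"
        using u by (auto simp: filterlim_at order_less_imp_not_eq2)
      ultimately show "(\<lambda>n. (exp (- u n * x) - 1 + u n * x) / (u n)\<^sup>2) \<longlonglongrightarrow> x\<^sup>2 / 2"
        by (rule filterlim_compose)
    qed
    show "(\<integral>x. (exp (- u n * x) - 1 + u n * x) / (u n)\<^sup>2 \<partial>D) \<le> K" for n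
      using K[of n] by (simp add: laplace_remainder_integral(1)[OF D u(1)])
  qed (auto intro!: nonneg_distribution_measurable[OF D(1)])
  then have "integrable D (\<lambda>x. 2 * (x\<^sup>2 / 2))"
    by (intro integrable_mult_right)
  then show ?thesis by simp
qed

section \<open>The functions sigma\<close>

definition sigma_integrand :: "real measure \<Rightarrow> real \<Rightarrow> real \<Rightarrow> real" where
  "sigma_integrand F s t = (if t = 0 then mean F * s else (1 - laplace_stieltjes F (t * s)) / t)"

lemma sigma_T_eq: "sigma_T FT F s = (\<integral>t. sigma_integrand F s t \<partial>FT)"
  by (simp add: sigma_T_def sigma_integrand_def)

lemma borel_measurable_laplace [measurable]:
  assumes "nonneg_distribution D"
  shows "laplace_stieltjes D \<in> borel_measurable borel"
proof -
  interpret sigma_finite_measure D by (rule nonneg_distributionD[OF assms])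
  have [measurable_cong]: "sets D = sets borel" by (rule nonneg_distributionD[OF assms])
  show ?thesis unfolding laplace_stieltjes_def[abs_def] by measurable
qed

lemma borel_measurable_sigma_integrand [measurable]:
  assumes "nonneg_distribution F"
  shows "sigma_integrand F s \<in> borel_measurable borel"
  using borel_measurable_laplace[OF assms] unfolding sigma_integrand_def[abs_def] by measurable

lemma sigma_integrand_nonneg:
  assumes "nonneg_distribution F" "0 \<le> s" "0 \<le> t"
  shows "0 \<le> sigma_integrand F s t"
  using assms mean_nonneg[OF assms(1)] laplace_le_1[OF assms(1), of "t * s"]
  by (simp add: sigma_integrand_def)

text \<open>
  The factor \<open>t\<close> from the argument of \<open>L F\<close> cancels the division by \<open>t\<close>, so the Lipschitz constant
  in \<open>s\<close> does not depend on \<open>t\<close>.  Integration over \<open>t\<close> then preserves the constant.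
\<close>

lemma sigma_integrand_lipschitz:
  assumes F: "nonneg_distribution F" "mean_finite F" and xy: "0 \<le> x" "0 \<le> y" and t: "0 \<le> t"
  shows "\<bar>sigma_integrand F x t - sigma_integrand F y t\<bar> \<le> mean F * \<bar>x - y\<bar>"
proof (cases "t = 0")
  case True
  then show ?thesis
    using mean_nonneg[OF F(1)] by (simp add: sigma_integrand_def abs_mult flip: right_diff_distrib)
next
  case False
  with t have "0 < t" by simp
  have "\<bar>sigma_integrand F x t - sigma_integrand F y t\<bar>
      = \<bar>laplace_stieltjes F (t * x) - laplace_stieltjes F (t * y)\<bar> / t"
    using \<open>0 < t\<close> by (simp add: sigma_integrand_def abs_minus_commute flip: diff_divide_distrib)
  also have "\<dots> \<le> mean F * \<bar>t * x - t * y\<bar> / t"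
    using laplace_lipschitz[OF F, of "t * x" "t * y"] \<open>0 < t\<close> xy by (simp add: divide_right_mono)
  also have "\<dots> = mean F * \<bar>x - y\<bar>"
    using \<open>0 < t\<close> by (simp add: abs_mult flip: right_diff_distrib)
  finally show ?thesis .
qed

lemma sigma_integrand_0: "nonneg_distribution F \<Longrightarrow> sigma_integrand F 0 t = 0"
  by (simp add: sigma_integrand_def laplace_0)

lemma sigma_integrand_le:
  assumes "nonneg_distribution F" "mean_finite F" "0 \<le> s" "0 \<le> t"
  shows "sigma_integrand F s t \<le> mean F * s"
  using sigma_integrand_lipschitz[OF assms(1,2,3) order_refl assms(4)] assms
  by (simp add: sigma_integrand_0)

lemma sigma_integrand_continuous:
  assumes F: "nonneg_distribution F" "mean_finite F" and s: "0 \<le> s"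
  shows "continuous_on {0..} (sigma_integrand F s)"
proof (cases "s = 0")
  case True
  then show ?thesis using F by (simp add: sigma_integrand_0)
next
  case False
  with s have "0 < s" by simp
  have cont: "continuous_on {0..} (laplace_stieltjes F)"
    by (rule lipschitz_on_continuous_on[of "mean F"], rule lipschitz_onI)
       (use laplace_lipschitz[OF F] mean_nonneg[OF F(1)] in \<open>auto simp: dist_real_def\<close>)
  have "continuous (at t within {0..}) (sigma_integrand F s)" if "0 \<le> t" for t
  proof (cases "t = 0")
    case True
    have "((\<lambda>t. s * ((1 - laplace_stieltjes F (t * s)) / (t * s))) \<longlongrightarrow> s * mean F) (at_right 0)"
    proof (intro tendsto_intros)
      have "filterlim (\<lambda>t. t * s) (at_right 0) (at_right 0)"
        using \<open>0 < s\<close> by real_asymp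
      from filterlim_compose[OF laplace_first_order_limit[OF F] this]
      show "((\<lambda>t. (1 - laplace_stieltjes F (t * s)) / (t * s)) \<longlongrightarrow> mean F) (at_right 0)" .
    qed
    moreover have "eventually (\<lambda>t. s * ((1 - laplace_stieltjes F (t * s)) / (t * s)) = sigma_integrand F s t)
        (at_right 0)"
      using eventually_at_right_less[of 0]
      by eventually_elim (use \<open>0 < s\<close> in \<open>simp add: sigma_integrand_def\<close>)
    ultimately have "(sigma_integrand F s \<longlongrightarrow> sigma_integrand F s 0) (at_right 0)"
      by (simp add: sigma_integrand_def[of F s 0] mult.commute Lim_transform_eventually)
    then show ?thesis
      unfolding continuous_within True by (simp add: at_within_Ici_at_right)
  next
    case False
    with that have "0 < t" by simp
    have *: "continuous_on {0<..} (\<lambda>t. (1 - laplace_stieltjes F (t * s)) / t)"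
      by (intro continuous_intros continuous_on_compose2[OF cont]) (use s in auto)
    have "continuous_on {0<..} (sigma_integrand F s)"
      by (rule continuous_on_eq[OF *]) (simp add: sigma_integrand_def)
    then have "isCont (sigma_integrand F s) t"
      using \<open>0 < t\<close> continuous_on_interior[of "{0<..}" "sigma_integrand F s" t]
      by (simp add: interior_open)
    then show ?thesis by (rule continuous_at_imp_continuous_within)
  qed
  then show ?thesis by (simp add: continuous_on_eq_continuous_within)
qed

lemma sigma_integrand_integrable:
  assumes "nonneg_distribution FT" and F: "nonneg_distribution F" "mean_finite F" and "0 \<le> s"
  shows "integrable FT (sigma_integrand F s)"
proof (rule nonneg_distribution_integrable_bounded[OF assms(1)])
  show "sigma_integrand F s \<in> borel_measurable borel"
    by (rule borel_measurable_sigma_integrand[OF F(1)])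
  show "\<bar>sigma_integrand F s t\<bar> \<le> mean F * s" if "0 \<le> t" for t
    using sigma_integrand_le[OF F \<open>0 \<le> s\<close> that] sigma_integrand_nonneg[OF F(1) \<open>0 \<le> s\<close> that] by simp
qed

lemma sigma_T_nonneg:
  assumes "nonneg_distribution FT" "nonneg_distribution F" "0 \<le> s"
  shows "0 \<le> sigma_T FT F s"
  unfolding sigma_T_eq
  by (rule nonneg_distribution_integral_nonneg[OF assms(1) sigma_integrand_nonneg[OF assms(2,3)]])

lemma sigma_T_lipschitz:
  assumes FT: "nonneg_distribution FT" and F: "nonneg_distribution F" "mean_finite F"
    and xy: "0 \<le> x" "0 \<le> y"
  shows "\<bar>sigma_T FT F x - sigma_T FT F y\<bar> \<le> mean F * \<bar>x - y\<bar>"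
proof -
  note int = sigma_integrand_integrable[OF FT F]
  have "\<bar>sigma_T FT F x - sigma_T FT F y\<bar> = \<bar>\<integral>t. sigma_integrand F x t - sigma_integrand F y t \<partial>FT\<bar>"
    using int xy by (simp add: sigma_T_eq)
  also have "\<dots> \<le> (\<integral>t. \<bar>sigma_integrand F x t - sigma_integrand F y t\<bar> \<partial>FT)"
    by (rule integral_abs_bound)
  also have "\<dots> \<le> mean F * \<bar>x - y\<bar>"
    by (rule nonneg_distribution_integral_le_const[OF FT _ sigma_integrand_lipschitz[OF F xy]])
       (use int xy in auto)
  finally show ?thesis .
qed

lemma sigma_T_0: "nonneg_distribution F \<Longrightarrow> sigma_T FT F 0 = 0"
  by (simp add: sigma_T_eq sigma_integrand_0)

lemma sigma_T_le:
  assumes "nonneg_distribution FT" "nonneg_distribution F" "mean_finite F" "0 \<le> s"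
  shows "sigma_T FT F s \<le> mean F * s"
  using sigma_T_lipschitz[OF assms order_refl] assms by (simp add: sigma_T_0)

lemma sigma_T_first_order_limit:
  assumes FT: "nonneg_distribution FT" and F: "nonneg_distribution F" "mean_finite F"
  shows "((\<lambda>s. sigma_T FT F s / s) \<longlongrightarrow> mean F) (at_right 0)"
proof -
  interpret prob_space FT by (rule nonneg_distributionD[OF FT])
  have "((\<lambda>s. \<integral>t. sigma_integrand F s t / s \<partial>FT) \<longlongrightarrow> (\<integral>t. mean F \<partial>FT)) (at_right 0)"
  proof (rule integral_dominated_convergence_at_right[where w = "\<lambda>_. mean F"])
    show "AE t in FT. ((\<lambda>s. sigma_integrand F s t / s) \<longlongrightarrow> mean F) (at_right 0)"
      using nonneg_distributionD(5)[OF FT]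
    proof eventually_elim
      case (elim t)
      show ?case
      proof (cases "t = 0")
        case True
        have "eventually (\<lambda>s. mean F = sigma_integrand F s t / s) (at_right 0)"
          using eventually_at_right_less[of 0]
          by eventually_elim (simp add: sigma_integrand_def True)
        then show ?thesis by (rule Lim_transform_eventually[OF tendsto_const])
      next
        case False
        then have t: "0 < t" using elim by simp
        have "filterlim (\<lambda>s. t * s) (at_right 0) (at_right 0)"
          using t by real_asymp
        from filterlim_compose[OF laplace_first_order_limit[OF F] this]
        have "((\<lambda>s. (1 - laplace_stieltjes F (t * s)) / (t * s)) \<longlongrightarrow> mean F) (at_right 0)" .
        then show ?thesis using t by (simp add: sigma_integrand_def)
      qed
    qed
    show "AE t in FT. \<bar>sigma_integrand F s t / s\<bar> \<le> mean F" if "0 < s" for s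
      using nonneg_distributionD(5)[OF FT]
    proof eventually_elim
      case (elim t)
      show ?case 
        using sigma_integrand_le[OF F _ elim, of s] sigma_integrand_nonneg[OF F(1) _ elim, of s] that
        by (simp add: pos_divide_le_eq)
    qed
    show "(\<lambda>t. sigma_integrand F s t / s) \<in> borel_measurable FT" if "0 < s" for s
      using borel_measurable_sigma_integrand[OF F(1)]
      by (intro nonneg_distribution_measurable[OF FT]) simp
  qed auto
  then show ?thesis by (simp add: sigma_T_eq prob_space)
qed

text \<open>
  The second order remainder of the integrand carries a factor \<open>t\<close>.  This is where the mean of
  \<open>T\<close> comes from.  At \<open>t = 0\<close> both sides vanish.
\<close>

lemma sigma_integrand_second_order:
  assumes "0 < s"
  shows "(mean F * s - sigma_integrand F s t) / s\<^sup>2 = t * laplace_remainder F (t * s)"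
  using assms by (simp add: sigma_integrand_def laplace_remainder_def power2_eq_square field_simps)

lemma sigma_T_second_order_integral:
  assumes "nonneg_distribution FT" "nonneg_distribution F" "mean_finite F" "0 < s"
  shows "(mean F * s - sigma_T FT F s) / s\<^sup>2 = (\<integral>t. t * laplace_remainder F (t * s) \<partial>FT)"
    "integrable FT (\<lambda>t. t * laplace_remainder F (t * s))"
proof -
  interpret prob_space FT by (rule nonneg_distributionD[OF assms(1)])
  show "(mean F * s - sigma_T FT F s) / s\<^sup>2 = (\<integral>t. t * laplace_remainder F (t * s) \<partial>FT)"
    using sigma_integrand_integrable[OF assms(1-3), of s] assms(4)
    by (simp add: prob_space sigma_T_eq flip: sigma_integrand_second_order[OF assms(4)])
  show "integrable FT (\<lambda>t. t * laplace_remainder F (t * s))"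
    using sigma_integrand_integrable[OF assms(1-3), of s] assms(4)
    by (simp flip: sigma_integrand_second_order[OF assms(4)])
qed

lemma scaled_remainder_nonneg:
  assumes "nonneg_distribution F" "mean_finite F" "0 < s" "0 \<le> t"
  shows "0 \<le> t * laplace_remainder F (t * s)"
  using laplace_remainder_nonneg[OF assms(1,2), of "t * s"] assms by (cases "t = 0") auto

lemma scaled_remainder_le:
  assumes "nonneg_distribution F" "mean_finite F" "integrable F (\<lambda>x. x\<^sup>2)" "0 < s" "0 \<le> t"
  shows "t * laplace_remainder F (t * s) \<le> t * ((\<integral>x. x\<^sup>2 \<partial>F) / 2)"
  using laplace_remainder_le[OF assms(1-3), of "t * s"] assms
  by (cases "t = 0") (auto intro!: mult_left_mono)

lemma scaled_remainder_limit:
  assumes F: "nonneg_distribution F" "mean_finite F" "integrable F (\<lambda>x. x\<^sup>2)" and "0 \<le> t"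
  shows "((\<lambda>s. t * laplace_remainder F (t * s)) \<longlongrightarrow> t * ((\<integral>x. x\<^sup>2 \<partial>F) / 2)) (at_right 0)"
proof (cases "t = 0")
  case False
  then have t: "0 < t" using assms by simp
  have "filterlim (\<lambda>s. t * s) (at_right 0) (at_right 0)"
    using t by real_asymp
  from tendsto_mult_left[OF filterlim_compose[OF laplace_remainder_limit[OF F] this]]
  show ?thesis by simp
qed simp

lemma sigma_T_second_order_le:
  assumes FT: "nonneg_distribution FT" "mean_finite FT"
    and F: "nonneg_distribution F" "mean_finite F" "integrable F (\<lambda>x. x\<^sup>2)" and s: "0 < s"
  shows "(mean F * s - sigma_T FT F s) / s\<^sup>2 \<le> mean FT * ((\<integral>x. x\<^sup>2 \<partial>F) / 2)"
proof -
  have "(\<integral>t. t * laplace_remainder F (t * s) \<partial>FT) \<le> (\<integral>t. t * ((\<integral>x. x\<^sup>2 \<partial>F) / 2) \<partial>FT)"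
  proof (rule nonneg_distribution_integral_mono[OF FT(1)])
    show "integrable FT (\<lambda>t. t * ((\<integral>x. x\<^sup>2 \<partial>F) / 2))"
      using FT(2) by (rule integrable_mult_left)
  qed (use scaled_remainder_le[OF F s] sigma_T_second_order_integral(2)[OF FT(1) F(1,2) s] in auto)
  also have "\<dots> = mean FT * ((\<integral>x. x\<^sup>2 \<partial>F) / 2)"
    by (rule integral_mult_left_zero)
  finally show ?thesis 
    by (simp only: sigma_T_second_order_integral(1)[OF FT(1) F(1,2) s])
qed

lemma sigma_T_second_order_limit:
  assumes FT: "nonneg_distribution FT" "mean_finite FT"
    and F: "nonneg_distribution F" "mean_finite F" "integrable F (\<lambda>x. x\<^sup>2)"
  shows "((\<lambda>s. (mean F * s - sigma_T FT F s) / s\<^sup>2) \<longlongrightarrow> mean FT * ((\<integral>x. x\<^sup>2 \<partial>F) / 2)) (at_right 0)"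
proof -
  have w: "integrable FT (\<lambda>t. t * ((\<integral>x. x\<^sup>2 \<partial>F) / 2))"
    using FT(2) by (rule integrable_mult_left)
  have lim: "((\<lambda>s. \<integral>t. t * laplace_remainder F (t * s) \<partial>FT)
      \<longlongrightarrow> (\<integral>t. t * ((\<integral>x. x\<^sup>2 \<partial>F) / 2) \<partial>FT)) (at_right 0)"
  proof (rule integral_dominated_convergence_at_right[OF _ _ w])
    show "AE t in FT. ((\<lambda>s. t * laplace_remainder F (t * s)) \<longlongrightarrow> t * ((\<integral>x. x\<^sup>2 \<partial>F) / 2)) (at_right 0)"
      using nonneg_distributionD(5)[OF FT(1)]
      by eventually_elim (rule scaled_remainder_limit[OF F])
    show "AE t in FT. \<bar>t * laplace_remainder F (t * s)\<bar> \<le> t * ((\<integral>x. x\<^sup>2 \<partial>F) / 2)" if "0 < s" for s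
      using nonneg_distributionD(5)[OF FT(1)]
    proof eventually_elim
      case (elim t)
      show ?case 
        unfolding abs_of_nonneg[OF scaled_remainder_nonneg[OF F(1,2) that elim]]
        by (rule scaled_remainder_le[OF F that elim])
    qed
    show "(\<lambda>t. t * ((\<integral>x. x\<^sup>2 \<partial>F) / 2)) \<in> borel_measurable FT"
      using w by (rule borel_measurable_integrable)
    show "(\<lambda>t. t * laplace_remainder F (t * s)) \<in> borel_measurable FT" if "0 < s" for s
      using sigma_T_second_order_integral(2)[OF FT(1) F(1,2) that] by (rule borel_measurable_integrable)
  qed
  have eq: "(\<integral>t. t * ((\<integral>x. x\<^sup>2 \<partial>F) / 2) \<partial>FT) = mean FT * ((\<integral>x. x\<^sup>2 \<partial>F) / 2)"
    by (rule integral_mult_left_zero)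
  have "eventually (\<lambda>s. (\<integral>t. t * laplace_remainder F (t * s) \<partial>FT)
      = (mean F * s - sigma_T FT F s) / s\<^sup>2) (at_right 0)"
    using eventually_at_right_less[of 0]
    by eventually_elim (rule sigma_T_second_order_integral(1)[OF FT(1) F(1,2), symmetric])
  then show ?thesis
    by (rule Lim_transform_eventually[OF lim[unfolded eq]])
qed

text \<open>
  By Fatou's lemma a bound on the second order quotients of \<open>\<sigma>\<close> bounds \<open>E[T] E[X\<^sup>2] / 2\<close>, and the
  factor \<open>E[X\<^sup>2] > 0\<close> can be divided out.
\<close>

lemma mean_finite_if_bounded_sigma_T_second_order:
  assumes FT: "nonneg_distribution FT"
    and F: "nonneg_distribution F" "mean_finite F" "integrable F (\<lambda>x. x\<^sup>2)" "0 < (\<integral>x. x\<^sup>2 \<partial>F)"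
    and u: "\<And>n. 0 < u n" "u \<longlonglongrightarrow> 0"
    and K: "\<And>n. (mean F * u n - sigma_T FT F (u n)) / (u n)\<^sup>2 \<le> K"
  shows "mean_finite FT"
proof -
  have "integrable FT (\<lambda>t. t * ((\<integral>x. x\<^sup>2 \<partial>F) / 2))"
  proof (rule integrable_limit_of_bounded_integrals)
    show "integrable FT (\<lambda>t. t * laplace_remainder F (t * u n))" for n
      by (rule sigma_T_second_order_integral(2)[OF FT F(1,2) u(1)])
    show "AE t in FT. 0 \<le> t * laplace_remainder F (t * u n)" for n
      using nonneg_distributionD(5)[OF FT]
      by eventually_elim (rule scaled_remainder_nonneg[OF F(1,2) u(1)])
    have u': "filterlim u (at_right 0) sequentially"
      using u by (auto simp: filterlim_at order_less_imp_not_eq2)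
    show "AE t in FT. (\<lambda>n. t * laplace_remainder F (t * u n)) \<longlonglongrightarrow> t * ((\<integral>x. x\<^sup>2 \<partial>F) / 2)"
      using nonneg_distributionD(5)[OF FT]
      by eventually_elim (rule filterlim_compose[OF scaled_remainder_limit[OF F(1-3)] u'])
    show "(\<integral>t. t * laplace_remainder F (t * u n) \<partial>FT) \<le> K" for n
      using K[of n] by (simp only: sigma_T_second_order_integral(1)[OF FT F(1,2) u(1)])
    show "(\<lambda>t. t * ((\<integral>x. x\<^sup>2 \<partial>F) / 2)) \<in> borel_measurable FT"
      by (rule nonneg_distribution_measurable[OF FT]) measurable
  qed
  then have "integrable FT (\<lambda>t. t * ((\<integral>x. x\<^sup>2 \<partial>F) / 2) * (2 / (\<integral>x. x\<^sup>2 \<partial>F)))"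
    by (rule integrable_mult_left)
  moreover have "t * ((\<integral>x. x\<^sup>2 \<partial>F) / 2) * (2 / (\<integral>x. x\<^sup>2 \<partial>F)) = t" for t
    using F(4) by simp
  ultimately show ?thesis by simp
qed

text \<open>
  A difference \<open>K (t s)\<^sup>2\<close> of the transforms at \<open>t s\<close> becomes \<open>t K s\<^sup>2\<close> after division by \<open>t\<close>, and
  integrating \<open>t\<close> yields \<open>E[T]\<close>.  The equal means take care of the atom of \<open>T\<close> at \<open>0\<close>.
\<close>

lemma sigma_T_contraction:
  assumes FT: "nonneg_distribution FT" "mean_finite FT"
    and F: "nonneg_distribution F" "mean_finite F" and G: "nonneg_distribution G" "mean_finite G"
    and eq: "mean F = mean G" and s: "0 \<le> s"
    and K: "\<And>x. 0 \<le> x \<Longrightarrow> \<bar>laplace_stieltjes F x - laplace_stieltjes G x\<bar> \<le> K * x\<^sup>2"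
  shows "\<bar>sigma_T FT F s - sigma_T FT G s\<bar> \<le> mean FT * K * s\<^sup>2"
proof -
  note intF = sigma_integrand_integrable[OF FT(1) F s] and intG = sigma_integrand_integrable[OF FT(1) G s]
  have "\<bar>sigma_T FT F s - sigma_T FT G s\<bar> = \<bar>\<integral>t. sigma_integrand F s t - sigma_integrand G s t \<partial>FT\<bar>"
    using intF intG by (simp add: sigma_T_eq)
  also have "\<dots> \<le> (\<integral>t. \<bar>sigma_integrand F s t - sigma_integrand G s t\<bar> \<partial>FT)"
    by (rule integral_abs_bound)
  also have "\<dots> \<le> (\<integral>t. t * (K * s\<^sup>2) \<partial>FT)"
  proof (rule nonneg_distribution_integral_mono[OF FT(1)])
    show "integrable FT (\<lambda>t. t * (K * s\<^sup>2))"
      using FT(2) by (rule integrable_mult_left)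
    show "\<bar>sigma_integrand F s t - sigma_integrand G s t\<bar> \<le> t * (K * s\<^sup>2)" if "0 \<le> t" for t
    proof (cases "t = 0")
      case True
      then show ?thesis by (simp add: sigma_integrand_def eq)
    next
      case False
      with that have t: "0 < t" by simp
      have "\<bar>sigma_integrand F s t - sigma_integrand G s t\<bar> 
          = \<bar>laplace_stieltjes F (t * s) - laplace_stieltjes G (t * s)\<bar> / t"
        using t by (simp add: sigma_integrand_def abs_minus_commute flip: diff_divide_distrib)
      also have "\<dots> \<le> K * (t * s)\<^sup>2 / t"
        using K[of "t * s"] t s by (simp add: divide_right_mono)
      also have "\<dots> = t * (K * s\<^sup>2)"
        using t by (simp add: power2_eq_square)
      finally show ?thesis .
    qed
  qed (use intF intG in auto)
  also have "\<dots> = mean FT * K * s\<^sup>2"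
    by simp
  finally show ?thesis .
qed

text \<open>
  Integrating \<open>exp (- t b)\<close> over \<open>t \<in> [0, s]\<close> gives \<open>(1 - exp (- s b)) / b\<close>, which is the
  integrand of \<open>\<sigma>\<close> for the unit mass at \<open>1\<close>.  Fubini's theorem does the rest.  All properties of
  \<open>\<sigma>\<^sub>B\<close> are special cases of those of \<open>\<sigma>\<close>.
\<close>

lemma sigma_B_eq_sigma_T:
  assumes FB: "nonneg_distribution FB" and s: "0 \<le> s"
  shows "sigma_B FB s = sigma_T FB (return borel 1) s"
proof -
  interpret B: prob_space FB by (rule nonneg_distributionD[OF FB])
  interpret pair_sigma_finite FB lborel
    by (intro pair_sigma_finite.intro nonneg_distributionD[OF FB]) unfold_locales
  have [measurable_cong]: "sets FB = sets borel" by (rule nonneg_distributionD[OF FB])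
  have one: "nonneg_distribution (return borel (1::real))" by (rule nonneg_distribution_return) simp
  define f where "f b t = exp (- t * b) * indicator {0..s} t" for b t :: real
  have inner: "has_bochner_integral lborel (f b) (sigma_integrand (return borel 1) s b)" for b
  proof (cases "b = 0")
    case True
    then have "f b = indicator {0..s}" by (auto simp: f_def fun_eq_iff)
    moreover have "sigma_integrand (return borel 1) s b = measure lborel {0..s}"
      using s True by (simp add: sigma_integrand_def return_moments)
    ultimately show ?thesis
      using has_bochner_integral_real_indicator[of "{0..s}" lborel] s by simp
  next
    case False
    have "has_bochner_integral lborel (\<lambda>t. exp (- t * b) * indicator {0..s} t)
        (- exp (- s * b) / b - - exp (- 0 * b) / b)"
      by (rule has_bochner_integral_FTC_Icc_real[OF s])
         (use False in \<open>auto intro!: derivative_eq_intros simp: field_simps\<close>)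
    then show ?thesis
      using False by (simp add: f_def[abs_def] sigma_integrand_def laplace_return diff_divide_distrib mult.commute)
  qed
  have "(\<integral>t. (\<integral>b. f b t \<partial>FB) \<partial>lborel) = (\<integral>b. (\<integral>t. f b t \<partial>lborel) \<partial>FB)"
  proof (rule Fubini_integral, rule Fubini_integrable)
    show "(\<lambda>(b, t). f b t) \<in> borel_measurable (FB \<Otimes>\<^sub>M lborel)"
      unfolding f_def by measurable
    have "(\<integral>t. norm (case (b, t) of (b, t) \<Rightarrow> f b t) \<partial>lborel) = sigma_integrand (return borel 1) s b" for b
      using has_bochner_integral_integral_eq[OF inner[of b]] by (simp add: f_def[abs_def])
    then show "integrable FB (\<lambda>b. \<integral>t. norm (case (b, t) of (b, t) \<Rightarrow> f b t) \<partial>lborel)"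
      using sigma_integrand_integrable[OF FB one return_moments(2) s] by simp
    show "AE b in FB. integrable lborel (\<lambda>t. case (b, t) of (b, t) \<Rightarrow> f b t)"
      by (intro AE_I2) (simp add: integrable.intros[OF inner])
  qed
  moreover have "(\<integral>b. f b t \<partial>FB) = indicator {0..s} t *\<^sub>R laplace_stieltjes FB t" for t
    by (simp add: f_def laplace_stieltjes_def)
  ultimately show ?thesis
    using has_bochner_integral_integral_eq[OF inner]
    by (simp add: sigma_B_def set_lebesgue_integral_def sigma_T_eq)
qed

section \<open>Uniqueness of the transform\<close>

text \<open>
  The transform at the natural numbers gives the moments of the image of the distribution under
  \<open>y \<mapsto> exp (- y)\<close>, which lives on \<open>[0, 1]\<close>; polynomials are uniformly dense in the continuous
  functions there.
\<close>

lemma integral_comp_exp_eq_of_laplace_eq: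
  fixes h :: "real \<Rightarrow> real"
  assumes F: "nonneg_distribution F" and G: "nonneg_distribution G"
    and eq: "\<And>s. 0 \<le> s \<Longrightarrow> laplace_stieltjes F s = laplace_stieltjes G s"
    and h: "continuous_on {0..1} h" "h \<in> borel_measurable borel"
  shows "(\<integral>y. h (exp (- y)) \<partial>F) = (\<integral>y. h (exp (- y)) \<partial>G)"
proof -
  have compact: "compact (h ` {0..1})"
    using h(1) by (rule compact_continuous_image) simp
  then obtain B where B: "\<And>u. 0 \<le> u \<Longrightarrow> u \<le> 1 \<Longrightarrow> \<bar>h u\<bar> \<le> B"
    using compact_imp_bounded[OF compact] unfolding bounded_iff
    by (metis atLeastAtMost_iff imageI real_norm_def)
  have int_h: "integrable D (\<lambda>y. h (exp (- y)))" if "nonneg_distribution D" for D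
    by (rule nonneg_distribution_integrable_bounded[OF that, where B = B])
       (use B h(2) in \<open>auto intro: measurable_compose[OF _ h(2)]\<close>)
  have "\<bar>(\<integral>y. h (exp (- y)) \<partial>F) - (\<integral>y. h (exp (- y)) \<partial>G)\<bar> \<le> e" if e: "0 < e" for e
  proof -
    (* Allow e / 2 of approximation error for each of the two distributions. *)
    obtain g where g: "real_polynomial_function g" 
      and close: "\<And>u. u \<in> {0..1} \<Longrightarrow> \<bar>h u - g u\<bar> < e / 2"
      by (rule Stone_Weierstrass_real_polynomial_function[OF compact_Icc h(1) half_gt_zero[OF e]]) blast
    obtain a n where g_eq: "g = (\<lambda>x. \<Sum>i\<le>n. a i * x ^ i)"
      using real_polynomial_function_imp_sum[OF g] by auto
    have pow: "exp (- y) ^ i = exp (- real i * y)" for y :: real and i :: nat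
      by (simp add: exp_of_nat_mult[symmetric])
    have int_g: "integrable D (\<lambda>y. g (exp (- y)))"
      and integral_g: "(\<integral>y. g (exp (- y)) \<partial>D) = (\<Sum>i\<le>n. a i * laplace_stieltjes D (real i))"
      if "nonneg_distribution D" for D
      using laplace_integrable[OF that]
      by (simp_all add: g_eq pow laplace_stieltjes_def del: mult_minus_left)
    have approx: "\<bar>(\<integral>y. h (exp (- y)) \<partial>D) - (\<integral>y. g (exp (- y)) \<partial>D)\<bar> \<le> e / 2"
      if D: "nonneg_distribution D" for D
    proof -
      have "\<bar>(\<integral>y. h (exp (- y)) \<partial>D) - (\<integral>y. g (exp (- y)) \<partial>D)\<bar>
          = \<bar>\<integral>y. h (exp (- y)) - g (exp (- y)) \<partial>D\<bar>"
        using int_h[OF D] int_g[OF D] by simp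
      also have "\<dots> \<le> (\<integral>y. \<bar>h (exp (- y)) - g (exp (- y))\<bar> \<partial>D)"
        by (rule integral_abs_bound)
      also have "\<dots> \<le> e / 2"
        by (rule nonneg_distribution_integral_le_const[OF D])
           (use int_h[OF D] int_g[OF D] close in \<open>auto intro: less_imp_le\<close>)
      finally show ?thesis .
    qed
    have "(\<integral>y. g (exp (- y)) \<partial>F) = (\<integral>y. g (exp (- y)) \<partial>G)"
      by (simp add: integral_g F G eq)
    then show ?thesis
      using approx[OF F] approx[OF G] by linarith
  qed
  then show ?thesis
    using field_le_epsilon[of "\<bar>(\<integral>y. h (exp (- y)) \<partial>F) - (\<integral>y. h (exp (- y)) \<partial>G)\<bar>" 0] by simp
qed

lemma cts_step_continuous: "a < b \<Longrightarrow> continuous_on S (cts_step a b)"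
  using uniformly_continuous_imp_continuous[OF cts_step_uniformly_continuous]
  by (rule continuous_on_subset) auto

lemma cts_step_abs_le_1: "a < b \<Longrightarrow> \<bar>cts_step a b x\<bar> \<le> 1"
  by (auto simp: cts_step_def abs_le_iff field_simps)

text \<open>
  In the variable \<open>u = exp (- y)\<close> a step function that vanishes for large \<open>y\<close> vanishes near
  \<open>u = 0\<close>, and so it extends continuously to \<open>u = 0\<close>.
\<close>

lemma integral_cts_step_eq_of_laplace_eq:
  assumes F: "nonneg_distribution F" and G: "nonneg_distribution G"
    and eq: "\<And>s. 0 \<le> s \<Longrightarrow> laplace_stieltjes F s = laplace_stieltjes G s" and "x < y"
  shows "(\<integral>z. cts_step x y z \<partial>F) = (\<integral>z. cts_step x y z \<partial>G)"
proof -
  define h where "h u = (if u \<le> 0 then 0 else cts_step x y (- ln u))" for u :: real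
  have "continuous_on {0<..} (\<lambda>u::real. cts_step x y (- ln u))"
    by (intro continuous_on_compose2[OF cts_step_continuous[OF \<open>x < y\<close>, of UNIV]] continuous_intros) auto
  then have right: "continuous_on {0<..} h"
    by (rule continuous_on_eq) (simp add: h_def)
  have zero: "h u = 0" if "u < exp (- y)" for u
  proof (cases "u \<le> 0")
    case False
    then have "ln u < - y" using that by (metis exp_less_cancel_iff exp_ln not_le)
    then show ?thesis using \<open>x < y\<close> by (simp add: h_def cts_step_def)
  qed (simp add: h_def)
  have left: "continuous_on {..<exp (- y)} h"
    by (rule continuous_on_eq[OF continuous_on_const[of _ 0]]) (simp add: zero)
  have "continuous_on ({..<exp (- y)} \<union> {0<..}) h"
    by (rule continuous_on_open_Un[OF _ _ left right]) auto
  moreover have "{..<exp (- y)} \<union> {0<..} = (UNIV :: real set)"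
    using exp_gt_zero[of "- y"] by (auto simp: not_less intro: le_less_trans)
  ultimately have h: "continuous_on UNIV h" by simp
  have "h (exp (- z)) = cts_step x y z" for z
    by (simp add: h_def)
  with integral_comp_exp_eq_of_laplace_eq[OF F G eq continuous_on_subset[OF h]
      borel_measurable_continuous_onI[OF h]]
  show ?thesis by simp
qed

theorem laplace_stieltjes_unique:
  assumes F: "nonneg_distribution F" and G: "nonneg_distribution G"
    and eq: "\<And>s. 0 \<le> s \<Longrightarrow> laplace_stieltjes F s = laplace_stieltjes G s"
  shows "F = G"
proof (rule cdf_unique)
  show "real_distribution F" "real_distribution G"
    using F G by (auto simp: nonneg_distribution_def)
  have lim: "(\<lambda>n. \<integral>z. cts_step x (x + 1 / Suc n) z \<partial>D) \<longlonglongrightarrow> cdf D x"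
    if D: "nonneg_distribution D" for D x
  proof -
    interpret real_distribution D by (rule nonneg_distributionD[OF D])
    have "(\<lambda>n. \<integral>z. cts_step x (x + 1 / Suc n) z \<partial>D) \<longlonglongrightarrow> (\<integral>z. indicator {..x} z \<partial>D)"
    proof (rule integral_dominated_convergence[where w = "\<lambda>_. 1"])
      show "AE z in D. (\<lambda>n. cts_step x (x + 1 / Suc n) z) \<longlonglongrightarrow> indicator {..x} z"
      proof (rule AE_I2)
        fix z
        show "(\<lambda>n. cts_step x (x + 1 / Suc n) z) \<longlonglongrightarrow> indicator {..x} z"
        proof (cases "z \<le> x")
          case False
          have "(\<lambda>n. x + 1 / Suc n) \<longlonglongrightarrow> x + 0"
            by (intro tendsto_intros LIMSEQ_Suc[OF lim_1_over_n])
          then have "eventually (\<lambda>n. x + 1 / Suc n < z) sequentially"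
            using False by (intro order_tendstoD(2)) auto
          then have "eventually (\<lambda>n. cts_step x (x + 1 / Suc n) z = 0) sequentially"
            by eventually_elim (use False in \<open>simp add: cts_step_def\<close>)
          then show ?thesis using False by (simp add: tendsto_eventually)
        qed (simp add: cts_step_def)
      qed
      show "AE z in D. norm (cts_step x (x + 1 / Suc n) z) \<le> 1" for n
        by (intro AE_I2) (simp add: cts_step_abs_le_1)
      show "cts_step x (x + 1 / Suc n) \<in> borel_measurable D" for n
        using integrable_cts_step[of x "x + 1 / Suc n"] by simp
    qed auto
    then show ?thesis by (simp add: cdf_def)
  qed
  show "cdf F = cdf G"
  proof
    fix x
    show "cdf F x = cdf G x"
    proof (rule LIMSEQ_unique[OF lim[OF F]])
      show "(\<lambda>n. \<integral>z. cts_step x (x + 1 / Suc n) z \<partial>F) \<longlonglongrightarrow> cdf G x"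
        using lim[OF G, of x] by (subst integral_cts_step_eq_of_laplace_eq[OF F G eq]) auto
    qed
  qed
qed

section \<open>The continuity theorem\<close>

text \<open>
  The truncated integrand is bounded and continuous on the whole line, as weak convergence and
  the monadic integral formula require.
\<close>

lemma laplace_eq_max:
  assumes "nonneg_distribution D"
  shows "laplace_stieltjes D s = (\<integral>y. exp (- s * max 0 y) \<partial>D)"
  unfolding laplace_stieltjes_def
proof (rule integral_cong_AE)
  show "AE y in D. exp (- s * y) = exp (- s * max 0 y)"
    using nonneg_distributionD(5)[OF assms] by eventually_elim simp
qed (auto intro!: nonneg_distribution_measurable[OF assms])

text \<open>
  Markov's inequality for \<open>1 - exp (- \<delta> y)\<close>: it is at least \<open>1 - exp (- 1)\<close> where \<open>y > 1 / \<delta>\<close>.  The left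
  end point \<open>- 1\<close> makes the half-open interval contain a possible atom at \<open>0\<close>.
\<close>

lemma laplace_tail_bound:
  assumes D: "nonneg_distribution D" and "0 < \<delta>"
    and L: "1 - e * (1 - exp (- 1)) < laplace_stieltjes D \<delta>"
  shows "1 - e < measure D {- 1<..1 / \<delta>}"
proof -
  interpret real_distribution D by (rule nonneg_distributionD[OF D])
  let ?A = "{- 1<..1 / \<delta>}"
  have c: "0 < 1 - exp (- 1 :: real)" by simp
  have int: "integrable D (indicator ?A :: real \<Rightarrow> real)"
    by (rule nonneg_distribution_integrable_bounded[OF D, where B = 1]) (auto simp: indicator_def)
  have "laplace_stieltjes D \<delta> \<le> (\<integral>y. exp (- 1) + (1 - exp (- 1)) * indicator ?A y \<partial>D)"
    unfolding laplace_stieltjes_def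
  proof (rule nonneg_distribution_integral_mono[OF D laplace_integrable[OF D]])
    show "exp (- \<delta> * y) \<le> exp (- 1) + (1 - exp (- 1)) * indicator ?A y" if "0 \<le> y" for y
      using that \<open>0 < \<delta>\<close> by (auto simp: indicator_def field_simps)
  qed (use \<open>0 < \<delta>\<close> int in auto)
  also have "\<dots> = 1 - (1 - exp (- 1)) * (1 - measure D ?A)"
    using int by (simp add: prob_space[simplified] algebra_simps)
  finally have "(1 - exp (- 1)) * (1 - measure D ?A) < (1 - exp (- 1)) * e"
    using L[unfolded mult.commute[of e]] by linarith
  then have "1 - measure D ?A < e"
    using c by (simp only: mult_less_cancel_left_pos)
  then show ?thesis by simp
qed

definition is_laplace :: "(real \<Rightarrow> real) \<Rightarrow> bool" where
  "is_laplace \<phi> \<longleftrightarrow> (\<exists>D. nonneg_distribution D \<and> (\<forall>s\<ge>0. laplace_stieltjes D s = \<phi> s))"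

text \<open>
  Continuity of the limit at \<open>0\<close> makes the sequence tight.  By Helly's theorem a subsequence
  converges weakly, and its limit has the transform \<open>\<psi>\<close>, because the exponentials are bounded and
  continuous.
\<close>

theorem laplace_continuity_theorem:
  assumes \<phi>: "\<And>n. is_laplace (\<phi> n)"
    and lim: "\<And>s. 0 \<le> s \<Longrightarrow> (\<lambda>n. \<phi> n s) \<longlonglongrightarrow> \<psi> s"
    and cont: "(\<psi> \<longlongrightarrow> 1) (at_right 0)"
  shows "is_laplace \<psi>"
proof -
  from \<phi> obtain D where D: "\<And>n. nonneg_distribution (D n)"
    and L: "\<And>n s. 0 \<le> s \<Longrightarrow> laplace_stieltjes (D n) s = \<phi> n s"
    unfolding is_laplace_def by metis
  interpret D: real_distribution "D n" for n by (rule nonneg_distributionD[OF D])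
  have tight: "tight D"
    unfolding tight_def
  proof (intro conjI allI impI)
    fix e :: real assume "0 < e"
    define c where "c = 1 - e * (1 - exp (- 1))"
    have "c < 1" using \<open>0 < e\<close> by (simp add: c_def)
    have "eventually (\<lambda>s. c < \<psi> s) (at_right 0)"
      by (rule order_tendstoD(1)[OF cont \<open>c < 1\<close>])
    then obtain \<delta> where \<delta>: "0 < \<delta>" "c < \<psi> \<delta>"
      unfolding eventually_at_right[OF zero_less_one] by (metis dense)
    obtain N where N: "\<And>n. N \<le> n \<Longrightarrow> c < \<phi> n \<delta>"
      using order_tendstoD(1)[OF lim \<delta>(2)] \<delta>(1) by (auto simp: eventually_sequentially)
    (* The first N distributions need not satisfy the bound at \<delta>, but each is tight by itself. *)
    have "\<exists>\<delta>>0. c < laplace_stieltjes (D n) \<delta>" for n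
      using order_tendstoD(1)[OF laplace_tendsto_1[OF D] \<open>c < 1\<close>]
      unfolding eventually_at_right[OF zero_less_one] by (metis dense)
    then obtain \<delta>' where \<delta>': "\<And>n. 0 < \<delta>' n" "\<And>n. c < laplace_stieltjes (D n) (\<delta>' n)"
      by metis
    define b where "b = Max (insert (1 / \<delta>) ((\<lambda>n. 1 / \<delta>' n) ` {..<N}))"
    have b: "1 / \<delta> \<le> b" "\<And>n. n < N \<Longrightarrow> 1 / \<delta>' n \<le> b"
      unfolding b_def by (auto intro!: Max_ge)
    have "0 < b" using b(1) \<delta>(1) by (meson less_le_trans zero_less_divide_1_iff)
    have "1 - e < measure (D n) {- 1<..b}" for n
    proof -
      obtain d where d: "0 < d" "1 / d \<le> b" "c < laplace_stieltjes (D n) d"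
        using b \<delta> \<delta>' N[of n] L[of \<delta> n] by (metis less_imp_le not_le)
      have "1 - e < measure (D n) {- 1<..1 / d}"
        by (rule laplace_tail_bound[OF D d(1) d(3)[unfolded c_def]])
      also have "\<dots> \<le> measure (D n) {- 1<..b}"
        using d(2) by (intro D.finite_measure_mono) auto
      finally show ?thesis .
    qed
    with \<open>0 < b\<close> show "\<exists>a b. a < b \<and> (\<forall>n. 1 - e < measure (D n) {a<..b})"
      by (intro exI[of _ "- 1"] exI[of _ b]) auto
  qed (rule nonneg_distributionD[OF D])
  obtain r M where r: "strict_mono r" and M: "real_distribution M"
    and weak: "weak_conv_m (\<lambda>n. D (r n)) M"
    using tight_imp_convergent_subsubsequence[OF tight strict_mono_id] by (auto simp: comp_def)
  interpret M: real_distribution M by (rule M)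
  note conv = weak_conv_imp_integral_bdd_continuous_conv[OF D.real_distribution_axioms M weak]
  (* This bounded continuous function detects mass on the negative half-line. *)
  have "(\<lambda>n. \<integral>y. min 1 (max 0 (- y)) \<partial>D (r n)) \<longlonglongrightarrow> (\<integral>y. min 1 (max 0 (- y)) \<partial>M)"
    by (rule conv[where B = 1]) (auto intro!: continuous_intros)
  moreover have "(\<integral>y. min 1 (max 0 (- y)) \<partial>D (r n)) = 0" for n
    by (rule integral_eq_zero_AE, use nonneg_distributionD(5)[OF D] in eventually_elim) simp
  ultimately have "(\<integral>y. min 1 (max 0 (- y)) \<partial>M) = 0"
    by (simp add: LIMSEQ_const_iff)
  moreover have "integrable M (\<lambda>y. min 1 (max 0 (- y)))"
    by (rule M.integrable_const_bound[where B = 1]) auto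
  ultimately have "AE y in M. min 1 (max 0 (- y)) = 0"
    by (subst (asm) integral_nonneg_eq_0_iff_AE) auto
  then have "AE y in M. 0 \<le> y" by eventually_elim (auto simp: min_def max_def split: if_splits)
  with M have M': "nonneg_distribution M" by (simp add: nonneg_distribution_def)
  moreover have "laplace_stieltjes M s = \<psi> s" if "0 \<le> s" for s
  proof (rule LIMSEQ_unique)
    have "(\<lambda>n. \<integral>y. exp (- s * max 0 y) \<partial>D (r n)) \<longlonglongrightarrow> (\<integral>y. exp (- s * max 0 y) \<partial>M)"
      by (rule conv[where B = 1]) (use that in \<open>auto intro!: continuous_intros\<close>)
    then show "(\<lambda>n. \<phi> (r n) s) \<longlonglongrightarrow> laplace_stieltjes M s"
      by (simp add: L[OF that, symmetric] laplace_eq_max[OF D] laplace_eq_max[OF M'])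
    show "(\<lambda>n. \<phi> (r n) s) \<longlonglongrightarrow> \<psi> s"
      using LIMSEQ_subseq_LIMSEQ[OF lim[OF that] r] by (simp add: comp_def)
  qed
  ultimately show ?thesis unfolding is_laplace_def by blast
qed

section \<open>Constructions of transforms\<close>

lemma is_laplaceI: "nonneg_distribution D \<Longrightarrow> is_laplace (laplace_stieltjes D)"
  by (auto simp: is_laplace_def)

lemma is_laplace_cong:
  assumes "is_laplace \<phi>" "\<And>s. 0 \<le> s \<Longrightarrow> \<phi> s = \<psi> s"
  shows "is_laplace \<psi>"
  using assms by (auto simp: is_laplace_def)

lemma is_laplace_exp: "0 \<le> c \<Longrightarrow> is_laplace (\<lambda>s. exp (- s * c))"
  using is_laplaceI[OF nonneg_distribution_return] by (simp add: laplace_return[abs_def])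

lemma is_laplace_bounds:
  assumes "is_laplace \<phi>" "0 \<le> s"
  shows "0 \<le> \<phi> s" "\<phi> s \<le> 1"
  using assms laplace_nonneg laplace_le_1 unfolding is_laplace_def by (metis, metis)

lemma is_laplace_tendsto_1:
  assumes "is_laplace \<phi>"
  shows "(\<phi> \<longlongrightarrow> 1) (at_right 0)"
proof -
  obtain D where D: "nonneg_distribution D" and L: "\<And>s. 0 \<le> s \<Longrightarrow> laplace_stieltjes D s = \<phi> s"
    using assms by (auto simp: is_laplace_def)
  have "eventually (\<lambda>s. laplace_stieltjes D s = \<phi> s) (at_right 0)"
    using eventually_at_right_less[of 0] by eventually_elim (simp add: L)
  then show ?thesis by (rule Lim_transform_eventually[OF laplace_tendsto_1[OF D]])
qed

lemma is_laplace_scale: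
  assumes "is_laplace \<phi>" "0 \<le> t"
  shows "is_laplace (\<lambda>s. \<phi> (t * s))"
proof -
  obtain D where D: "nonneg_distribution D" and L: "\<And>s. 0 \<le> s \<Longrightarrow> laplace_stieltjes D s = \<phi> s"
    using assms by (auto simp: is_laplace_def)
  interpret real_distribution D by (rule nonneg_distributionD[OF D])
  let ?D = "distr D borel (\<lambda>y. t * y)"
  have "real_distribution ?D" by (rule real_distribution_distr) simp
  moreover have "AE y in ?D. 0 \<le> y"
    using nonneg_distributionD(5)[OF D] assms(2) by (subst AE_distr_iff) auto
  moreover have "laplace_stieltjes ?D s = \<phi> (t * s)" if "0 \<le> s" for s
    using L[of "t * s"] assms(2) that by (simp add: laplace_stieltjes_def integral_distr mult_ac)
  ultimately show ?thesis
    unfolding is_laplace_def nonneg_distribution_def by blast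
qed

text \<open>
  The transform of a sum of independent random variables is the product of their transforms.
\<close>

lemma is_laplace_mult:
  assumes "is_laplace \<phi>" "is_laplace \<psi>"
  shows "is_laplace (\<lambda>s. \<phi> s * \<psi> s)"
proof -
  obtain D E where D: "nonneg_distribution D" and L: "\<And>s. 0 \<le> s \<Longrightarrow> laplace_stieltjes D s = \<phi> s"
    and E: "nonneg_distribution E" and L': "\<And>s. 0 \<le> s \<Longrightarrow> laplace_stieltjes E s = \<psi> s"
    using assms by (auto simp: is_laplace_def)
  interpret D: real_distribution D by (rule nonneg_distributionD[OF D])
  interpret E: real_distribution E by (rule nonneg_distributionD[OF E])
  interpret P: pair_prob_space D E ..
  let ?C = "distr (D \<Otimes>\<^sub>M E) borel (\<lambda>(x, y). x + y)"
  have AE: "AE z in D \<Otimes>\<^sub>M E. 0 \<le> fst z \<and> 0 \<le> snd z"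
  proof (rule P.AE_pair_measure)
    show "AE x in D. AE y in E. 0 \<le> fst (x, y) \<and> 0 \<le> snd (x, y)"
      using nonneg_distributionD(5)[OF D]
      by eventually_elim (use nonneg_distributionD(5)[OF E] in simp)
  qed measurable
  have "real_distribution ?C"
    by (rule P.real_distribution_distr) measurable
  moreover have "AE y in ?C. 0 \<le> y"
    using AE by (subst AE_distr_iff) (auto elim: eventually_mono)
  moreover have "laplace_stieltjes ?C s = \<phi> s * \<psi> s" if s: "0 \<le> s" for s
  proof -
    have "laplace_stieltjes ?C s = (\<integral>z. exp (- s * (fst z + snd z)) \<partial>(D \<Otimes>\<^sub>M E))"
      unfolding laplace_stieltjes_def by (subst integral_distr) (auto simp: case_prod_beta)
    also have "\<dots> = (\<integral>x. (\<integral>y. exp (- s * (x + y)) \<partial>E) \<partial>D)"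
    proof (subst P.integral_fst'[symmetric])
      show "integrable (D \<Otimes>\<^sub>M E) (\<lambda>z. exp (- s * (fst z + snd z)))"
      proof (rule P.integrable_const_bound[where B = 1])
        show "AE z in D \<Otimes>\<^sub>M E. norm (exp (- s * (fst z + snd z))) \<le> 1"
          using AE by eventually_elim (use s in simp)
      qed simp
    qed simp
    also have "\<dots> = (\<integral>x. exp (- s * x) * laplace_stieltjes E s \<partial>D)"
      by (simp add: laplace_stieltjes_def distrib_left exp_diff divide_inverse exp_minus
          flip: exp_add)
    also have "\<dots> = \<phi> s * \<psi> s"
      using L[OF s] L'[OF s] by (simp add: laplace_stieltjes_def)
    finally show ?thesis .
  qed
  ultimately show ?thesis
    unfolding is_laplace_def nonneg_distribution_def by blast
qed

lemma is_laplace_power: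
  assumes "is_laplace \<phi>"
  shows "is_laplace (\<lambda>s. \<phi> s ^ n)"
proof (induction n)
  case 0
  then show ?case using is_laplace_exp[of 0] by simp
next
  case (Suc n)
  then show ?case using is_laplace_mult[OF assms] by simp
qed

text \<open>
  Over a discrete space every family of distributions is a measurable kernel, so the mixture is a
  monadic bind.  General mixtures are limits of these.
\<close>

lemma is_laplace_discrete_mixture:
  assumes P: "prob_space P" "sets P = UNIV" and \<phi>: "\<And>i. is_laplace (\<phi> i)"
  shows "is_laplace (\<lambda>s. \<integral>i. \<phi> i s \<partial>P)"
proof -
  from \<phi> obtain D where D: "\<And>i. nonneg_distribution (D i)"
    and L: "\<And>i s. 0 \<le> s \<Longrightarrow> laplace_stieltjes (D i) s = \<phi> i s"
    unfolding is_laplace_def by metis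
  interpret P: prob_space P by (rule P)
  interpret D: real_distribution "D i" for i by (rule nonneg_distributionD[OF D])
  have meas: "D \<in> measurable P (subprob_algebra borel)"
    unfolding measurable_def using P(2) 
    by (auto simp: space_subprob_algebra intro: D.subprob_space_axioms prob_space_imp_subprob_space D.prob_space_axioms)
  let ?M = "bind P D"
  have "prob_space ?M"
    by (rule P.prob_space_bind[OF _ meas]) (auto intro: D.prob_space_axioms)
  moreover have "sets ?M = sets borel"
    by (rule sets_bind_measurable[OF meas P.not_empty])
  moreover have "AE y in ?M. 0 \<le> y"
    using nonneg_distributionD(5)[OF D] by (subst AE_bind[OF meas]) auto
  ultimately have M: "nonneg_distribution ?M"
    by (simp add: nonneg_distribution_def real_distribution_def real_distribution_axioms_def)
  moreover have "laplace_stieltjes ?M s = (\<integral>i. \<phi> i s \<partial>P)" if s: "0 \<le> s" for s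
  proof -
    have "laplace_stieltjes ?M s = (\<integral>i. (\<integral>y. exp (- s * max 0 y) \<partial>D i) \<partial>P)"
      unfolding laplace_eq_max[OF M]
      by (rule integral_bind[where K = borel and B = 1 and B' = 1])
         (use s in \<open>auto intro: meas P.finite_measure_axioms simp: D.emeasure_space_1[simplified]\<close>)
    also have "\<dots> = (\<integral>i. \<phi> i s \<partial>P)"
      by (simp only: L[OF s, symmetric] laplace_eq_max[OF D])
    finally show ?thesis .
  qed
  ultimately show ?thesis unfolding is_laplace_def by blast
qed

text \<open>
  The mixing distribution is rounded down to multiples of \<open>1 / (n + 1)\<close>, which gives discrete mixtures, and
  these converge by continuity in \<open>t\<close>.  This avoids proving that the distributions form a measurable
  kernel in \<open>t\<close>.
\<close>

lemma is_laplace_mixture: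
  assumes G: "nonneg_distribution G" and \<phi>: "\<And>t. 0 \<le> t \<Longrightarrow> is_laplace (\<phi> t)"
    and cont: "\<And>s. 0 \<le> s \<Longrightarrow> continuous_on {0..} (\<lambda>t. \<phi> t s)"
    and meas: "\<And>s. (\<lambda>t. \<phi> t s) \<in> borel_measurable borel"
  shows "is_laplace (\<lambda>s. \<integral>t. \<phi> t s \<partial>G)"
proof (rule laplace_continuity_theorem)
  interpret G: real_distribution G by (rule nonneg_distributionD[OF G])
  define a where "a n t = real (nat \<lfloor>real (Suc n) * t\<rfloor>) / real (Suc n)" for n t
  have a_nonneg: "0 \<le> a n t" for n t by (simp add: a_def)
  have a_meas [measurable]: "a n \<in> borel_measurable borel" for n
    unfolding a_def by measurable
  have a_lim: "(\<lambda>n. a n t) \<longlonglongrightarrow> t" if "0 \<le> t" for t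
  proof (rule tendsto_sandwich)
    show "eventually (\<lambda>n. t - 1 / real (Suc n) \<le> a n t) sequentially"
    proof (intro always_eventually allI)
      fix n
      have "real (Suc n) * t - 1 \<le> real_of_int \<lfloor>real (Suc n) * t\<rfloor>" by linarith
      moreover have "0 \<le> real (Suc n) * t" using that by simp
      ultimately have "real (Suc n) * t - 1 \<le> real (nat \<lfloor>real (Suc n) * t\<rfloor>)" by linarith
      from divide_right_mono[OF this, of "real (Suc n)"] show "t - 1 / real (Suc n) \<le> a n t"
        by (simp add: a_def diff_divide_distrib del: of_nat_Suc)
    qed
    show "eventually (\<lambda>n. a n t \<le> t) sequentially"
    proof (intro always_eventually allI)
      fix n
      have "0 \<le> real (Suc n) * t" using that by simp
      then have "real (nat \<lfloor>real (Suc n) * t\<rfloor>) \<le> real (Suc n) * t" by linarith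
      from divide_right_mono[OF this, of "real (Suc n)"] show "a n t \<le> t"
        by (simp add: a_def del: of_nat_Suc)
    qed
    have "(\<lambda>n. t - 1 / real (Suc n)) \<longlonglongrightarrow> t - 0"
      by (intro tendsto_intros LIMSEQ_Suc[OF lim_1_over_n])
    then show "(\<lambda>n. t - 1 / real (Suc n)) \<longlonglongrightarrow> t" by simp
  qed simp
  show "is_laplace (\<lambda>s. \<integral>t. \<phi> (a n t) s \<partial>G)" for n
  proof -
    let ?P = "distr G (count_space UNIV) (\<lambda>t. nat \<lfloor>real (Suc n) * t\<rfloor>)"
    have "is_laplace (\<lambda>s. \<integral>i. \<phi> (real i / real (Suc n)) s \<partial>?P)"
    proof (rule is_laplace_discrete_mixture)
      show "prob_space ?P" by (rule G.prob_space_distr) measurable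
    qed (auto intro: \<phi>)
    moreover have "(\<integral>i. \<phi> (real i / real (Suc n)) s \<partial>?P) = (\<integral>t. \<phi> (a n t) s \<partial>G)" for s
      unfolding a_def by (rule integral_distr) measurable
    ultimately show ?thesis by simp
  qed
  have le_1: "\<bar>\<phi> t s\<bar> \<le> 1" if "0 \<le> t" "0 \<le> s" for t s
    using is_laplace_bounds[OF \<phi>[OF that(1)] that(2)] by simp
  have meas_G: "(\<lambda>t. \<phi> t s) \<in> borel_measurable G" for s
    by (rule nonneg_distribution_measurable[OF G meas])
  show "(\<lambda>n. \<integral>t. \<phi> (a n t) s \<partial>G) \<longlonglongrightarrow> (\<integral>t. \<phi> t s \<partial>G)" if s: "0 \<le> s" for s
  proof (rule integral_dominated_convergence[where w = "\<lambda>_. 1"])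
    show "AE t in G. (\<lambda>n. \<phi> (a n t) s) \<longlonglongrightarrow> \<phi> t s"
      using nonneg_distributionD(5)[OF G]
    proof eventually_elim
      case (elim t)
      then show ?case
        using continuous_on_tendsto_compose[OF cont[OF s] a_lim[OF elim]] a_nonneg by simp
    qed
    show "(\<lambda>t. \<phi> (a n t) s) \<in> borel_measurable G" for n
      by (rule nonneg_distribution_measurable[OF G]) (rule measurable_compose[OF a_meas meas])
    show "AE t in G. norm (\<phi> (a n t) s) \<le> 1" for n
      using le_1[OF a_nonneg s] by simp
  qed (auto intro: meas_G)
  have "((\<lambda>s. \<integral>t. \<phi> t s \<partial>G) \<longlongrightarrow> (\<integral>t. 1 \<partial>G)) (at_right 0)"
  proof (rule integral_dominated_convergence_at_right[where w = "\<lambda>_. 1"])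
    show "AE t in G. ((\<lambda>s. \<phi> t s) \<longlongrightarrow> 1) (at_right 0)"
      using nonneg_distributionD(5)[OF G]
      by eventually_elim (rule is_laplace_tendsto_1[OF \<phi>])
    show "AE t in G. \<bar>\<phi> t s\<bar> \<le> 1" if "0 < s" for s
      using nonneg_distributionD(5)[OF G] by eventually_elim (use le_1 that in auto)
  qed (auto intro: meas_G)
  then show "((\<lambda>s. \<integral>t. \<phi> t s \<partial>G) \<longlongrightarrow> 1) (at_right 0)"
    by (simp add: G.prob_space[simplified])
qed

section \<open>Laplace exponents\<close>

text \<open>
  Up to the restriction to \<open>s \<ge> 0\<close>, these are the Bernstein functions \<open>\<psi>\<close> with \<open>\<psi>(0) = \<psi>(0+) = 0\<close>: the
  functions \<open>exp (- c \<psi>)\<close> are the transforms of infinitely divisible distributions that form a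
  convolution semigroup in \<open>c\<close>.
\<close>

definition laplace_exponent :: "(real \<Rightarrow> real) \<Rightarrow> bool" where
  "laplace_exponent \<psi> \<longleftrightarrow> (\<forall>c\<ge>0. is_laplace (\<lambda>s. exp (- (c * \<psi> s))))"

lemma laplace_exponentD: "laplace_exponent \<psi> \<Longrightarrow> 0 \<le> c \<Longrightarrow> is_laplace (\<lambda>s. exp (- (c * \<psi> s)))"
  by (simp add: laplace_exponent_def)

lemma laplace_exponent_cong:
  assumes "laplace_exponent \<phi>" "\<And>s. 0 \<le> s \<Longrightarrow> \<phi> s = \<psi> s"
  shows "laplace_exponent \<psi>"
  using assms by (auto simp: laplace_exponent_def elim!: is_laplace_cong)

lemma laplace_exponent_linear: "0 \<le> m \<Longrightarrow> laplace_exponent (\<lambda>s. m * s)"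
  by (auto simp: laplace_exponent_def intro!: is_laplace_cong[OF is_laplace_exp[of "_ * m"]])

text \<open>
  The function \<open>exp (- c (1 - \<phi>))\<close> is the limit of the \<open>N\<close>-th powers of \<open>1 - p + p \<phi>\<close> with
  \<open>p = c / N\<close>, and \<open>1 - p + p \<phi>\<close> is the transform of a variable that is kept with probability \<open>p\<close> and
  replaced by \<open>0\<close> otherwise.
\<close>

lemma laplace_exponent_compound_Poisson:
  assumes \<phi>: "is_laplace \<phi>" and "0 \<le> r"
  shows "laplace_exponent (\<lambda>s. r * (1 - \<phi> s))"
proof -
  have "is_laplace (\<lambda>s. exp (- (c * (1 - \<phi> s))))" if "0 \<le> c" for c
  proof (rule laplace_continuity_theorem)
    (* A shift of the index that makes c / (n + k) a probability for all n. *)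
    define k where "k = Suc (nat \<lceil>c\<rceil>)"
    have k: "c \<le> real (n + k)" "0 < n + k" for n unfolding k_def by linarith+
    show "is_laplace (\<lambda>s. (1 + - (c * (1 - \<phi> s)) / real (n + k)) ^ (n + k))" for n
    proof (rule is_laplace_power)
      define p where "p = c / real (n + k)"
      have p: "0 \<le> p" "p \<le> 1" using k[of n] that by (auto simp: p_def)
      define \<theta> where "\<theta> b = (if b then \<phi> else (\<lambda>s. 1))" for b
      have "is_laplace (\<lambda>s. \<integral>b. \<theta> b s \<partial>measure_pmf (bernoulli_pmf p))"
        by (rule is_laplace_discrete_mixture)
           (use \<phi> is_laplace_exp[of 0] in \<open>auto simp: \<theta>_def measure_pmf.prob_space_axioms\<close>)
      moreover have "(\<integral>b. \<theta> b s \<partial>measure_pmf (bernoulli_pmf p)) = 1 + - (c * (1 - \<phi> s)) / real (n + k)" for s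
      proof -
        have "(\<integral>b. \<theta> b s \<partial>measure_pmf (bernoulli_pmf p)) = p * \<phi> s + (1 - p)"
          using p by (simp add: integral_bernoulli_pmf \<theta>_def)
        also have "\<dots> = 1 - p * (1 - \<phi> s)" by (simp add: algebra_simps)
        finally show ?thesis by (simp add: p_def)
      qed
      ultimately show "is_laplace (\<lambda>s. 1 + - (c * (1 - \<phi> s)) / real (n + k))" by simp
    qed
    show "(\<lambda>n. (1 + - (c * (1 - \<phi> s)) / real (n + k)) ^ (n + k)) \<longlonglongrightarrow> exp (- (c * (1 - \<phi> s)))" for s
      by (rule LIMSEQ_ignore_initial_segment[OF tendsto_exp_limit_sequentially])
    have "((\<lambda>s. exp (- (c * (1 - \<phi> s)))) \<longlongrightarrow> exp (- (c * (1 - 1)))) (at_right 0)"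
      by (intro tendsto_intros is_laplace_tendsto_1[OF \<phi>])
    then show "((\<lambda>s. exp (- (c * (1 - \<phi> s)))) \<longlongrightarrow> 1) (at_right 0)" by simp
  qed
  from this[of "c * r" for c] show ?thesis
    using assms(2) by (simp add: laplace_exponent_def mult.assoc)
qed

text \<open>
  With \<open>\<Psi>\<close> the mixture, \<open>exp (- c \<Psi>)\<close> is the limit of the \<open>n\<close>-th powers of the mixtures of
  \<open>exp (- (c / n) \<psi> t)\<close>: each mixture is \<open>1 - (c / n) \<Psi> + O(1 / n\<^sup>2)\<close>, because \<open>\<psi> t s\<close> is bounded in \<open>t\<close>.
  The linear bound also gives continuity at \<open>0\<close>.
\<close>

lemma laplace_exponent_mixture:
  assumes G: "nonneg_distribution G" and \<psi>: "\<And>t. 0 \<le> t \<Longrightarrow> laplace_exponent (\<psi> t)"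
    and cont: "\<And>s. 0 \<le> s \<Longrightarrow> continuous_on {0..} (\<lambda>t. \<psi> t s)"
    and meas: "\<And>s. (\<lambda>t. \<psi> t s) \<in> borel_measurable borel"
    and bounds: "\<And>s t. 0 \<le> s \<Longrightarrow> 0 \<le> t \<Longrightarrow> 0 \<le> \<psi> t s" "\<And>s t. 0 \<le> s \<Longrightarrow> 0 \<le> t \<Longrightarrow> \<psi> t s \<le> K * s"
  shows "laplace_exponent (\<lambda>s. \<integral>t. \<psi> t s \<partial>G)"
  unfolding laplace_exponent_def
proof (intro allI impI)
  fix c :: real assume c: "0 \<le> c"
  interpret G: real_distribution G by (rule nonneg_distributionD[OF G])
  define \<Psi> where "\<Psi> s = (\<integral>t. \<psi> t s \<partial>G)" for s
  have int_\<psi>: "integrable G (\<lambda>t. \<psi> t s)" if "0 \<le> s" for s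
    by (rule nonneg_distribution_integrable_bounded[OF G meas, where B = "K * s"])
       (use bounds that in auto)
  have \<Psi>_bounds: "0 \<le> \<Psi> s" "\<Psi> s \<le> K * s" if "0 \<le> s" for s
  proof -
    show "0 \<le> \<Psi> s" unfolding \<Psi>_def
      by (rule nonneg_distribution_integral_nonneg[OF G bounds(1)[OF that]])
    show "\<Psi> s \<le> K * s" unfolding \<Psi>_def
      by (rule nonneg_distribution_integral_le_const[OF G int_\<psi>[OF that] bounds(2)[OF that]])
  qed
  define A where "A n s = (\<integral>t. exp (- (c / Suc n * \<psi> t s)) \<partial>G)" for n s
  show "is_laplace (\<lambda>s. exp (- (c * (\<integral>t. \<psi> t s \<partial>G))))"
    unfolding \<Psi>_def[symmetric]
  proof (rule laplace_continuity_theorem)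
    have A: "is_laplace (A n)" for n
      unfolding A_def[abs_def]
    proof (rule is_laplace_mixture[OF G])
      show "is_laplace (\<lambda>s. exp (- (c / real (Suc n) * \<psi> t s)))" if "0 \<le> t" for t
        by (rule laplace_exponentD[OF \<psi>[OF that]]) (use c in simp)
      show "continuous_on {0..} (\<lambda>t. exp (- (c / real (Suc n) * \<psi> t s)))" if "0 \<le> s" for s
        by (intro continuous_intros cont that)
      show "(\<lambda>t. exp (- (c / real (Suc n) * \<psi> t s))) \<in> borel_measurable borel" for s
        using meas[of s] by measurable
    qed
    then show "is_laplace (\<lambda>s. A n s ^ Suc n)" for n by (rule is_laplace_power)
    show "(\<lambda>n. A n s ^ Suc n) \<longlonglongrightarrow> exp (- (c * \<Psi> s))" if s: "0 \<le> s" for s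
    proof -
      define B where "B = c * (K * s)"
      have close: "\<bar>A n s ^ Suc n - exp (- (c * \<Psi> s))\<bar> \<le> B\<^sup>2 * (1 / Suc n)" for n
      proof -
        define d where "d = c / Suc n"
        have d: "0 \<le> d" using c by (simp add: d_def)
        define Q where "Q = (d * (K * s))\<^sup>2 / 2"
        have expand: "0 \<le> exp (- (d * x)) - (1 - d * x)" "exp (- (d * x)) - (1 - d * x) \<le> Q"
          if "0 \<le> x" "x \<le> K * s" for x
        proof -
          show "0 \<le> exp (- (d * x)) - (1 - d * x)"
            using exp_ge_add_one_self[of "- (d * x)"] by linarith
          have "(d * x)\<^sup>2 \<le> (d * (K * s))\<^sup>2"
            using that d by (intro power_mono mult_left_mono) auto
          moreover have "exp (- (d * x)) - 1 + d * x \<le> (d * x)\<^sup>2 / 2"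
            by (rule exp_minus_le_quadratic) (use that d in simp)
          ultimately show "exp (- (d * x)) - (1 - d * x) \<le> Q"
            unfolding Q_def by linarith
        qed
        have int_exp: "integrable G (\<lambda>t. exp (- (d * \<psi> t s)))"
        proof (rule nonneg_distribution_integrable_bounded[OF G, where B = 1])
          show "(\<lambda>t. exp (- (d * \<psi> t s))) \<in> borel_measurable borel"
            using meas[of s] by measurable
        qed (use d bounds(1)[OF s] in auto)
        have "A n s - (1 - d * \<Psi> s) = (\<integral>t. exp (- (d * \<psi> t s)) - (1 - d * \<psi> t s) \<partial>G)"
          using int_exp int_\<psi>[OF s] 
          by (simp add: A_def d_def[symmetric] \<Psi>_def G.prob_space[simplified] del: of_nat_Suc)
        moreover have "0 \<le> \<dots>"
          by (rule nonneg_distribution_integral_nonneg[OF G]) (use expand(1) bounds s in blast)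
        moreover have "(\<integral>t. exp (- (d * \<psi> t s)) - (1 - d * \<psi> t s) \<partial>G) \<le> Q"
          by (rule nonneg_distribution_integral_le_const[OF G])
             (use int_exp int_\<psi>[OF s] expand(2) bounds s in auto)
        ultimately have "0 \<le> A n s - (1 - d * \<Psi> s)" "A n s - (1 - d * \<Psi> s) \<le> Q" by simp_all
        with expand[OF \<Psi>_bounds[OF s]] have *: "\<bar>A n s - exp (- (d * \<Psi> s))\<bar> \<le> Q"
          by linarith
        have "exp (- (c * \<Psi> s)) = exp (- (d * \<Psi> s)) ^ Suc n"
          by (simp add: d_def del: power_Suc flip: exp_of_nat_mult)
        then have "\<bar>A n s ^ Suc n - exp (- (c * \<Psi> s))\<bar>
            = norm (A n s ^ Suc n - exp (- (d * \<Psi> s)) ^ Suc n)" by simp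
        also have "\<dots> \<le> Suc n * norm (A n s - exp (- (d * \<Psi> s)))"
          by (rule norm_power_diff)
             (use is_laplace_bounds[OF A s] d \<Psi>_bounds[OF s] in auto)
        also have "\<dots> \<le> Suc n * Q"
          using * by (intro mult_left_mono) auto
        also have "\<dots> = B\<^sup>2 * (1 / Suc n) / 2"
        proof -
          have "N * ((c / N * x)\<^sup>2 / 2) = (c * x)\<^sup>2 * (1 / N) / 2" if "N \<noteq> 0" for N x :: real
            using that by (simp add: power2_eq_square)
          from this[OF of_nat_neq_0, of n "K * s"] show ?thesis
            unfolding Q_def B_def d_def .
        qed
        also have "\<dots> \<le> B\<^sup>2 * (1 / Suc n)"
        proof -
          have "x / 2 \<le> x" if "0 \<le> x" for x :: real using that by simp
          then show ?thesis by this simp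
        qed
        finally show ?thesis .
      qed
      have "(\<lambda>n. B\<^sup>2 * (1 / Suc n)) \<longlonglongrightarrow> B\<^sup>2 * 0"
        by (intro tendsto_intros LIMSEQ_Suc[OF lim_1_over_n])
      then have "(\<lambda>n. A n s ^ Suc n - exp (- (c * \<Psi> s))) \<longlonglongrightarrow> 0"
        by (intro Lim_null_comparison[OF always_eventually[rule_format, of "\<lambda>n. norm (A n s ^ Suc n - exp (- (c * \<Psi> s))) \<le> B\<^sup>2 * (1 / Suc n)"]])
           (use close in auto)
      then show ?thesis by (rule LIM_zero_cancel)
    qed
    have "(\<Psi> \<longlongrightarrow> 0) (at_right 0)"
    proof (rule tendsto_sandwich)
      show "eventually (\<lambda>s. 0 \<le> \<Psi> s) (at_right 0)"
        using eventually_at_right_less[of 0] by eventually_elim (simp add: \<Psi>_bounds)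
      show "eventually (\<lambda>s. \<Psi> s \<le> K * s) (at_right 0)"
        using eventually_at_right_less[of 0] by eventually_elim (simp add: \<Psi>_bounds)
      have "((\<lambda>s. K * s) \<longlongrightarrow> K * 0) (at_right 0)" by (intro tendsto_intros)
      then show "((\<lambda>s. K * s) \<longlongrightarrow> 0) (at_right 0)" by simp
    qed simp
    then have "((\<lambda>s. exp (- (c * \<Psi> s))) \<longlongrightarrow> exp (- (c * 0))) (at_right 0)"
      by (intro tendsto_intros)
    then show "((\<lambda>s. exp (- (c * \<Psi> s))) \<longlongrightarrow> 1) (at_right 0)" by simp
  qed
qed

text \<open>
  Subordination: \<open>L D (\<psi> s)\<close> is the mixture of \<open>exp (- y \<psi> s)\<close> over \<open>y\<close> distributed as \<open>D\<close>.
\<close>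

lemma is_laplace_compose:
  assumes D: "nonneg_distribution D" and \<psi>: "laplace_exponent \<psi>"
  shows "is_laplace (\<lambda>s. laplace_stieltjes D (\<psi> s))"
proof -
  have "is_laplace (\<lambda>s. \<integral>y. exp (- (y * \<psi> s)) \<partial>D)"
    by (rule is_laplace_mixture[OF D laplace_exponentD[OF \<psi>]]) (auto intro!: continuous_intros)
  then show ?thesis by (simp add: laplace_stieltjes_def mult.commute)
qed

lemma laplace_exponent_sigma_T:
  assumes FT: "nonneg_distribution FT" and F: "nonneg_distribution F" "mean_finite F"
  shows "laplace_exponent (sigma_T FT F)"
  unfolding sigma_T_eq[abs_def]
proof (rule laplace_exponent_mixture[OF FT, where K = "mean F"])
  show "laplace_exponent (\<lambda>s. sigma_integrand F s t)" if "0 \<le> t" for t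
  proof (cases "t = 0")
    case True
    then show ?thesis
      using laplace_exponent_linear[OF mean_nonneg[OF F(1)]] by (simp add: sigma_integrand_def)
  next
    case False
    have "laplace_exponent (\<lambda>s. 1 / t * (1 - laplace_stieltjes F (t * s)))"
      by (rule laplace_exponent_compound_Poisson[OF is_laplace_scale[OF is_laplaceI[OF F(1)] that]])
         (use that in simp)
    then show ?thesis using False by (simp add: sigma_integrand_def)
  qed
qed (auto intro: sigma_integrand_continuous[OF F] borel_measurable_sigma_integrand[OF F(1)]
    sigma_integrand_nonneg[OF F(1)] sigma_integrand_le[OF F])

lemma laplace_exponent_sigma_B:
  assumes "nonneg_distribution FB"
  shows "laplace_exponent (sigma_B FB)"
proof (rule laplace_exponent_cong)
  show "laplace_exponent (sigma_T FB (return borel 1))"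
    by (rule laplace_exponent_sigma_T[OF assms]) (auto intro: nonneg_distribution_return return_moments)
qed (simp add: sigma_B_eq_sigma_T[OF assms])

lemma laplace_exponent_compose:
  assumes \<xi>: "laplace_exponent \<xi>" and \<psi>: "laplace_exponent \<psi>" "\<And>s. 0 \<le> s \<Longrightarrow> 0 \<le> \<psi> s"
  shows "laplace_exponent (\<lambda>s. \<xi> (\<psi> s))"
  unfolding laplace_exponent_def
proof (intro allI impI)
  fix c :: real assume "0 \<le> c"
  then obtain D where D: "nonneg_distribution D" and L: "\<And>s. 0 \<le> s \<Longrightarrow> laplace_stieltjes D s = exp (- (c * \<xi> s))"
    using laplace_exponentD[OF \<xi>] by (auto simp: is_laplace_def)
  show "is_laplace (\<lambda>s. exp (- (c * \<xi> (\<psi> s))))"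
    by (rule is_laplace_cong[OF is_laplace_compose[OF D \<psi>(1)]]) (simp add: L \<psi>(2))
qed

section \<open>Distributions with a given mean and finite second moment\<close>

lemma second_moment_eq_variance:
  assumes D: "nonneg_distribution D" "mean_finite D"
  shows "integrable D (\<lambda>x. (x - mean D)\<^sup>2) \<longleftrightarrow> integrable D (\<lambda>x. x\<^sup>2)"
    and "integrable D (\<lambda>x. x\<^sup>2) \<Longrightarrow> var D = (\<integral>x. x\<^sup>2 \<partial>D) - (mean D)\<^sup>2"
proof -
  interpret prob_space D by (rule nonneg_distributionD[OF D(1)])
  show "integrable D (\<lambda>x. (x - mean D)\<^sup>2) \<longleftrightarrow> integrable D (\<lambda>x. x\<^sup>2)"
  proof
    assume "integrable D (\<lambda>x. (x - mean D)\<^sup>2)"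
    then have "integrable D (\<lambda>x. (x - mean D)\<^sup>2 + (2 * mean D * x - (mean D)\<^sup>2))"
      using D(2) by (intro Bochner_Integration.integrable_add Bochner_Integration.integrable_diff
          integrable_mult_right integrable_const)
    then show "integrable D (\<lambda>x. x\<^sup>2)" by (simp add: power2_eq_square algebra_simps)
  next
    assume "integrable D (\<lambda>x. x\<^sup>2)"
    then have "integrable D (\<lambda>x. x\<^sup>2 - (2 * mean D * x - (mean D)\<^sup>2))"
      using D(2) by (intro Bochner_Integration.integrable_add Bochner_Integration.integrable_diff
          integrable_mult_right integrable_const)
    then show "integrable D (\<lambda>x. (x - mean D)\<^sup>2)" by (simp add: power2_eq_square algebra_simps)
  qed
  show "integrable D (\<lambda>x. x\<^sup>2) \<Longrightarrow> var D = (\<integral>x. x\<^sup>2 \<partial>D) - (mean D)\<^sup>2"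
    by (rule variance_eq[OF D(2)])
qed

lemma mean_power2_le_second_moment:
  assumes D: "nonneg_distribution D" "mean_finite D" "integrable D (\<lambda>x. x\<^sup>2)"
  shows "(mean D)\<^sup>2 \<le> (\<integral>x. x\<^sup>2 \<partial>D)"
proof -
  have "0 \<le> var D" by simp
  then show ?thesis using second_moment_eq_variance(2)[OF D] by simp
qed

lemma sigma_B_nonneg: "nonneg_distribution FB \<Longrightarrow> 0 \<le> s \<Longrightarrow> 0 \<le> sigma_B FB s"
  using sigma_T_nonneg[OF _ nonneg_distribution_return[of 1]] by (simp add: sigma_B_eq_sigma_T)

lemma sigma_B_lipschitz:
  assumes "nonneg_distribution FB" "0 \<le> x" "0 \<le> y"
  shows "\<bar>sigma_B FB x - sigma_B FB y\<bar> \<le> \<bar>x - y\<bar>"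
  using sigma_T_lipschitz[OF assms(1) nonneg_distribution_return return_moments(2), of 1 x y] assms
  by (simp add: sigma_B_eq_sigma_T return_moments)

lemma sigma_B_le:
  assumes "nonneg_distribution FB" "0 \<le> s"
  shows "sigma_B FB s \<le> s"
  using sigma_T_le[OF assms(1) nonneg_distribution_return return_moments(2), of 1 s] assms
  by (simp add: sigma_B_eq_sigma_T return_moments)

lemma sigma_B_first_order_limit:
  assumes FB: "nonneg_distribution FB"
  shows "((\<lambda>s. sigma_B FB s / s) \<longlongrightarrow> 1) (at_right 0)"
proof -
  have "((\<lambda>s. sigma_T FB (return borel 1) s / s) \<longlongrightarrow> 1) (at_right 0)"
    using sigma_T_first_order_limit[OF FB nonneg_distribution_return return_moments(2), of 1]
    by (simp add: return_moments)
  moreover have "eventually (\<lambda>s. sigma_T FB (return borel 1) s / s = sigma_B FB s / s) (at_right 0)"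
    using eventually_at_right_less[of 0] by eventually_elim (simp add: sigma_B_eq_sigma_T[OF FB])
  ultimately show ?thesis by (rule Lim_transform_eventually)
qed

lemma sigma_B_second_order_le:
  assumes FB: "nonneg_distribution FB" "mean_finite FB" and s: "0 < s"
  shows "(s - sigma_B FB s) / s\<^sup>2 \<le> mean FB / 2"
  using sigma_T_second_order_le[OF FB nonneg_distribution_return return_moments(2,3) s, of 1] s
  by (simp add: sigma_B_eq_sigma_T[OF FB(1)] return_moments)

lemma sigma_B_second_order_limit:
  assumes FB: "nonneg_distribution FB" "mean_finite FB"
  shows "((\<lambda>s. (s - sigma_B FB s) / s\<^sup>2) \<longlongrightarrow> mean FB / 2) (at_right 0)"
proof -
  have "((\<lambda>s. (s - sigma_T FB (return borel 1) s) / s\<^sup>2) \<longlongrightarrow> mean FB / 2) (at_right 0)"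
    using sigma_T_second_order_limit[OF FB nonneg_distribution_return return_moments(2,3), of 1]
    by (simp add: return_moments)
  moreover have "eventually (\<lambda>s. (s - sigma_T FB (return borel 1) s) / s\<^sup>2 = (s - sigma_B FB s) / s\<^sup>2)
      (at_right 0)"
    using eventually_at_right_less[of 0] by eventually_elim (simp add: sigma_B_eq_sigma_T[OF FB(1)])
  ultimately show ?thesis by (rule Lim_transform_eventually)
qed

lemma mean_finite_if_bounded_sigma_B_second_order:
  assumes FB: "nonneg_distribution FB"
    and u: "\<And>n. 0 < u n" "u \<longlonglongrightarrow> 0"
    and K: "\<And>n. (u n - sigma_B FB (u n)) / (u n)\<^sup>2 \<le> K"
  shows "mean_finite FB"
proof (rule mean_finite_if_bounded_sigma_T_second_order[OF FB nonneg_distribution_return return_moments(2,3) _ u])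
  show "(mean (return borel 1) * u n - sigma_T FB (return borel 1) (u n)) / (u n)\<^sup>2 \<le> K" for n
    using K[of n] u(1)[of n] by (simp add: sigma_B_eq_sigma_T[OF FB] return_moments less_imp_le)
qed (auto simp: return_moments)

lemma eventually_at_right_0_sequence:
  fixes P :: "real \<Rightarrow> bool"
  assumes "eventually P (at_right 0)"
  obtains s where "\<And>n. 0 < s n" "\<And>n. P (s n)" "s \<longlonglongrightarrow> 0"
proof -
  obtain \<delta> where \<delta>: "0 < \<delta>" "\<And>x. 0 < x \<Longrightarrow> x < \<delta> \<Longrightarrow> P x"
    using assms unfolding eventually_at_right[OF zero_less_one] by blast
  define s where "s n = \<delta> * inverse (real (Suc (Suc n)))" for n
  have "0 < s n" for n using \<delta>(1) by (simp add: s_def)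
  moreover have "s n < \<delta> * 1" for n
    unfolding s_def using \<delta>(1) by (intro mult_strict_left_mono) (simp_all add: inverse_less_1_iff)
  moreover have "s \<longlonglongrightarrow> \<delta> * 0"
    unfolding s_def by (intro tendsto_intros LIMSEQ_Suc[OF LIMSEQ_inverse_real_of_nat])
  ultimately show ?thesis using \<delta>(2) by (intro that[of s]) auto
qed

lemma filterlim_at_right_0_if_ratio_limit_pos:
  fixes f :: "real \<Rightarrow> real"
  assumes lim: "((\<lambda>s. f s / s) \<longlongrightarrow> m) (at_right 0)" and "0 < m"
  shows "filterlim f (at_right 0) (at_right 0)"
proof -
  have "eventually (\<lambda>s. 0 < f s / s) (at_right 0)"
    by (rule order_tendstoD(1)[OF lim \<open>0 < m\<close>])
  then have pos: "eventually (\<lambda>s. 0 < f s) (at_right 0)"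
    using eventually_at_right_less[of 0] by eventually_elim (simp add: zero_less_divide_iff)
  have "((\<lambda>s. f s / s * s) \<longlongrightarrow> m * 0) (at_right 0)"
    by (intro tendsto_intros lim)
  moreover have "eventually (\<lambda>s. f s / s * s = f s) (at_right 0)"
    using eventually_at_right_less[of 0] by eventually_elim simp
  ultimately have "(f \<longlongrightarrow> 0) (at_right 0)"
    using Lim_transform_eventually by fastforce
  then show ?thesis
    using pos by (auto simp: filterlim_at elim: eventually_mono)
qed

definition second_order_distribution :: "real \<Rightarrow> real measure \<Rightarrow> bool" where
  "second_order_distribution \<mu> F \<longleftrightarrow>
     nonneg_distribution F \<and> mean_finite F \<and> mean F = \<mu> \<and> integrable F (\<lambda>x. x\<^sup>2)"

lemma second_order_distributionD:
  assumes "second_order_distribution \<mu> F"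
  shows "nonneg_distribution F" "mean_finite F" "mean F = \<mu>" "integrable F (\<lambda>x. x\<^sup>2)"
  using assms by (auto simp: second_order_distribution_def)

lemma second_order_distribution_return: "0 \<le> c \<Longrightarrow> second_order_distribution c (return borel c)"
  by (simp add: second_order_distribution_def nonneg_distribution_return return_moments)

text \<open>
  So any two distributions of this kind have transforms whose difference is at most a constant
  times \<open>s\<^sup>2\<close>; this starts the contraction argument.
\<close>

lemma second_order_distribution_expansion:
  assumes F: "second_order_distribution \<mu> F" and s: "0 \<le> s"
  shows "0 \<le> laplace_stieltjes F s - 1 + \<mu> * s"
    "laplace_stieltjes F s - 1 + \<mu> * s \<le> (\<integral>x. x\<^sup>2 \<partial>F) / 2 * s\<^sup>2"
proof -
  note F = second_order_distributionD[OF F]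
  have "0 \<le> laplace_stieltjes F s - 1 + \<mu> * s 
      \<and> laplace_stieltjes F s - 1 + \<mu> * s \<le> (\<integral>x. x\<^sup>2 \<partial>F) / 2 * s\<^sup>2"
  proof (cases "s = 0")
    case False
    with s have "0 < s" by simp
    have "laplace_stieltjes F s - 1 + \<mu> * s = laplace_remainder F s * s\<^sup>2"
      using \<open>0 < s\<close> F(3) by (simp add: laplace_remainder_def)
    moreover have "laplace_remainder F s * s\<^sup>2 \<le> (\<integral>x. x\<^sup>2 \<partial>F) / 2 * s\<^sup>2"
      by (rule mult_right_mono[OF laplace_remainder_le[OF F(1,2,4) \<open>0 < s\<close>]]) simp
    moreover have "0 \<le> laplace_remainder F s * s\<^sup>2"
      by (rule mult_nonneg_nonneg[OF laplace_remainder_nonneg[OF F(1,2) \<open>0 < s\<close>]]) simp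
    ultimately show ?thesis by (simp only:)
  qed (simp add: laplace_0[OF F(1)])
  then show "0 \<le> laplace_stieltjes F s - 1 + \<mu> * s"
    "laplace_stieltjes F s - 1 + \<mu> * s \<le> (\<integral>x. x\<^sup>2 \<partial>F) / 2 * s\<^sup>2" by auto
qed

text \<open>
  Recovers the moments of a distribution that is known only through its transform, such as the
  limit of an iteration.
\<close>

lemma second_order_distributionI_expansion:
  assumes G: "nonneg_distribution G"
    and C: "\<And>s. 0 < s \<Longrightarrow> \<bar>laplace_stieltjes G s - 1 + \<mu> * s\<bar> \<le> C * s\<^sup>2"
  shows "second_order_distribution \<mu> G"
proof -
  have quot: "\<bar>(1 - laplace_stieltjes G s) / s - \<mu>\<bar> \<le> C * s" if "0 < s" for s
  proof -
    have "(1 - laplace_stieltjes G s) / s - \<mu> = - (laplace_stieltjes G s - 1 + \<mu> * s) / s"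
      using that by (simp add: field_simps)
    then have "\<bar>(1 - laplace_stieltjes G s) / s - \<mu>\<bar> = \<bar>laplace_stieltjes G s - 1 + \<mu> * s\<bar> / s"
      using that by (simp only: abs_divide abs_minus_cancel abs_of_pos)
    also have "\<dots> \<le> C * s\<^sup>2 / s"
      using C[OF that] that by (intro divide_right_mono) auto
    finally show ?thesis using that by (simp add: power2_eq_square)
  qed
  have "0 \<le> C" using C[of 1] by (simp add: order_trans[OF abs_ge_zero])
  define u where "u n = 1 / real (Suc n)" for n
  have u: "0 < u n" "u n \<le> 1" for n by (simp_all add: u_def)
  have u_lim: "u \<longlonglongrightarrow> 0" unfolding u_def by (rule LIMSEQ_Suc[OF lim_1_over_n])
  have mean: "mean_finite G"
  proof (rule mean_finite_if_bounded_difference_quotients[OF G u(1) u_lim])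
    show "(1 - laplace_stieltjes G (u n)) / u n \<le> \<mu> + C" for n
    proof -
      have "C * u n \<le> C * 1" by (rule mult_left_mono[OF u(2) \<open>0 \<le> C\<close>])
      then show ?thesis using quot[OF u(1)[of n]] by linarith
    qed
  qed
  have "((\<lambda>s. (1 - laplace_stieltjes G s) / s - \<mu>) \<longlongrightarrow> 0) (at_right 0)"
  proof (rule Lim_null_comparison)
    show "eventually (\<lambda>s. norm ((1 - laplace_stieltjes G s) / s - \<mu>) \<le> C * s) (at_right 0)"
      using eventually_at_right_less[of 0] by eventually_elim (simp only: quot real_norm_def)
    have "((\<lambda>s. C * s) \<longlongrightarrow> C * 0) (at_right 0)" by (intro tendsto_intros)
    then show "((\<lambda>s. C * s) \<longlongrightarrow> 0) (at_right 0)" by simp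
  qed
  then have "((\<lambda>s. (1 - laplace_stieltjes G s) / s) \<longlongrightarrow> \<mu>) (at_right 0)"
    by (rule LIM_zero_cancel)
  then have mean_eq: "mean G = \<mu>"
    using laplace_first_order_limit[OF G mean] by (intro tendsto_unique[OF trivial_limit_at_right_real])
  have "integrable G (\<lambda>x. x\<^sup>2)"
  proof (rule second_moment_finite_if_bounded_remainders[OF G mean u(1) u_lim])
    show "laplace_remainder G (u n) \<le> C" for n
      using C[OF u(1)[of n]] u(1)[of n]
      by (simp add: laplace_remainder_def mean_eq pos_divide_le_eq)
  qed
  then show ?thesis
    using G mean mean_eq by (simp add: second_order_distribution_def)
qed

section \<open>The functional equation\<close>

locale functional_equation =
  fixes FT FA FB :: "real measure"
  assumes FT: "nonneg_distribution FT" and FA: "nonneg_distribution FA" and FB: "nonneg_distribution FB"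
begin

definition exponent :: "real measure \<Rightarrow> real \<Rightarrow> real" where
  "exponent F s = sigma_B FB (sigma_T FT F s)"

lemma solves_equation_iff:
  "solves_equation FT FA FB F \<longleftrightarrow> (\<forall>s\<ge>0. laplace_stieltjes F s = laplace_stieltjes FA (exponent F s))"
proof -
  have "exp (- u) powr a = exp (- u * a)" for u a :: real
    by (simp add: powr_def)
  then show ?thesis
    by (simp add: solves_equation_def laplace_stieltjes_def[of FA] exponent_def)
qed

lemma solution_with_mean_iff:
  "solution_with_mean FT FA FB \<mu> F \<longleftrightarrow> second_order_distribution \<mu> F \<and>
     (\<forall>s\<ge>0. laplace_stieltjes F s = laplace_stieltjes FA (exponent F s))"
  unfolding solution_with_mean_def solves_equation_iff second_order_distribution_def
  using second_moment_eq_variance(1)[of F] by blast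

lemma solution_with_meanD:
  assumes "solution_with_mean FT FA FB \<mu> F"
  shows "second_order_distribution \<mu> F"
    and "0 \<le> s \<Longrightarrow> laplace_stieltjes F s = laplace_stieltjes FA (exponent F s)"
  using assms by (simp_all add: solution_with_mean_iff)

lemma exponent_bounds:
  assumes F: "second_order_distribution \<mu> F" and s: "0 \<le> s"
  shows "0 \<le> exponent F s" "exponent F s \<le> sigma_T FT F s" "sigma_T FT F s \<le> \<mu> * s"
proof -
  note F = second_order_distributionD[OF F]
  note \<sigma> = sigma_T_nonneg[OF FT F(1) s]
  show "0 \<le> exponent F s" "exponent F s \<le> sigma_T FT F s"
    using sigma_B_nonneg[OF FB \<sigma>] sigma_B_le[OF FB \<sigma>] by (simp_all add: exponent_def)
  show "sigma_T FT F s \<le> \<mu> * s"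
    using sigma_T_le[OF FT F(1,2) s] F(3) by simp
qed

lemma sigma_T_ratio:
  assumes F: "second_order_distribution \<mu> F"
  shows "((\<lambda>s. sigma_T FT F s / s) \<longlongrightarrow> \<mu>) (at_right 0)"
  using sigma_T_first_order_limit[OF FT] second_order_distributionD[OF F] by blast

lemma sigma_T_at_right:
  assumes F: "second_order_distribution \<mu> F" "0 < \<mu>"
  shows "filterlim (sigma_T FT F) (at_right 0) (at_right 0)"
  by (rule filterlim_at_right_0_if_ratio_limit_pos[OF sigma_T_ratio[OF F(1)] F(2)])

lemma exponent_ratio:
  assumes F: "second_order_distribution \<mu> F" "0 < \<mu>"
  shows "((\<lambda>s. exponent F s / s) \<longlongrightarrow> \<mu>) (at_right 0)"
proof -
  have "((\<lambda>s. sigma_B FB (sigma_T FT F s) / sigma_T FT F s * (sigma_T FT F s / s)) \<longlongrightarrow> 1 * \<mu>) (at_right 0)"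
    by (intro tendsto_mult sigma_T_ratio F
        filterlim_compose[OF sigma_B_first_order_limit[OF FB] sigma_T_at_right[OF F]])
  moreover have "eventually (\<lambda>s. 0 < sigma_T FT F s) (at_right 0)"
    using sigma_T_at_right[OF F] unfolding filterlim_at by (auto elim: eventually_mono)
  then have "eventually (\<lambda>s. sigma_B FB (sigma_T FT F s) / sigma_T FT F s * (sigma_T FT F s / s)
      = exponent F s / s) (at_right 0)"
    by eventually_elim (simp add: exponent_def)
  ultimately show ?thesis using Lim_transform_eventually by fastforce
qed

lemma exponent_at_right:
  assumes F: "second_order_distribution \<mu> F" "0 < \<mu>"
  shows "filterlim (exponent F) (at_right 0) (at_right 0)"
  by (rule filterlim_at_right_0_if_ratio_limit_pos[OF exponent_ratio[OF F] F(2)])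

text \<open>
  The three sources of the second moment: \<open>T\<close>, \<open>B\<close> and \<open>A\<close>, each with its remainder expressed
  in the variable in which its limit is known.  The mean of \<open>A\<close> being \<open>1\<close> makes the
  first order terms telescope from \<open>\<mu> s\<close> over \<open>\<sigma>\<close> to \<open>u\<close>.
\<close>

lemma second_order_decomposition:
  assumes "mean FA = 1" "0 < s" "sigma_T FT F s \<noteq> 0" "exponent F s \<noteq> 0"
  shows "(laplace_stieltjes FA (exponent F s) - 1 + \<mu> * s) / s\<^sup>2 =
      (\<mu> * s - sigma_T FT F s) / s\<^sup>2
      + (sigma_T FT F s - sigma_B FB (sigma_T FT F s)) / (sigma_T FT F s)\<^sup>2 * (sigma_T FT F s / s)\<^sup>2
      + laplace_remainder FA (exponent F s) * (exponent F s / s)\<^sup>2"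
proof -
  have "laplace_stieltjes FA (exponent F s) = 1 - exponent F s + (exponent F s)\<^sup>2 * laplace_remainder FA (exponent F s)"
    using laplace_expansion[OF assms(4), of FA] assms(1) by simp
  then have "laplace_stieltjes FA (exponent F s) - 1 + \<mu> * s = (\<mu> * s - sigma_T FT F s)
      + (sigma_T FT F s - exponent F s) + laplace_remainder FA (exponent F s) * (exponent F s)\<^sup>2"
    by simp
  moreover have "(sigma_T FT F s - exponent F s) / (sigma_T FT F s)\<^sup>2 * (sigma_T FT F s / s)\<^sup>2
      = (sigma_T FT F s - exponent F s) / s\<^sup>2"
    using assms(3) by (simp add: power_divide)
  ultimately show ?thesis
    by (simp only: exponent_def[symmetric] add_divide_distrib power_divide times_divide_eq_right)
qed

text \<open>
  Both \<open>L FA\<close> and \<open>\<sigma>\<^sub>B\<close> have Lipschitz constant at most \<open>1\<close>, and \<open>\<sigma>\<close> contributes the factor \<open>E[T]\<close>.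
\<close>

lemma exponent_contraction:
  assumes "mean_finite FT" "mean_finite FA" "mean FA = 1"
    and F: "second_order_distribution \<mu> F" and G: "second_order_distribution \<mu> G" and s: "0 \<le> s"
    and K: "\<And>x. 0 \<le> x \<Longrightarrow> \<bar>laplace_stieltjes F x - laplace_stieltjes G x\<bar> \<le> K * x\<^sup>2"
  shows "\<bar>laplace_stieltjes FA (exponent F s) - laplace_stieltjes FA (exponent G s)\<bar> \<le> mean FT * K * s\<^sup>2"
proof -
  note F' = second_order_distributionD[OF F] and G' = second_order_distributionD[OF G]
  have "\<bar>laplace_stieltjes FA (exponent F s) - laplace_stieltjes FA (exponent G s)\<bar> \<le> \<bar>exponent F s - exponent G s\<bar>"
    using laplace_lipschitz[OF FA assms(2) exponent_bounds(1)[OF F s] exponent_bounds(1)[OF G s]] assms(3)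
    by simp
  also have "\<dots> \<le> \<bar>sigma_T FT F s - sigma_T FT G s\<bar>"
    unfolding exponent_def
    by (rule sigma_B_lipschitz[OF FB sigma_T_nonneg[OF FT F'(1) s] sigma_T_nonneg[OF FT G'(1) s]])
  also have "\<dots> \<le> mean FT * K * s\<^sup>2"
    by (rule sigma_T_contraction[OF FT assms(1) F'(1,2) G'(1,2) _ s K]) (simp_all add: F' G')
  finally show ?thesis .
qed

text \<open>
  The limit of the second order decomposition as \<open>s\<close> tends to \<open>0\<close>.
\<close>

lemma second_moment_equation:
  assumes \<mu>: "0 < \<mu>" and sol: "solution_with_mean FT FA FB \<mu> F"
    and fin: "mean_finite FT" "mean_finite FA" "integrable FA (\<lambda>a. a\<^sup>2)" "mean_finite FB"
    and mean_FA: "mean FA = 1"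
  shows "(1 - mean FT) * (\<integral>x. x\<^sup>2 \<partial>F) = ((\<integral>a. a\<^sup>2 \<partial>FA) + mean FB) * \<mu>\<^sup>2"
proof -
  note F = solution_with_meanD(1)[OF sol] and eq = solution_with_meanD(2)[OF sol]
  note F' = second_order_distributionD[OF F]
  have pos: "eventually (\<lambda>s. 0 < sigma_T FT F s) (at_right 0)" "eventually (\<lambda>s. 0 < exponent F s) (at_right 0)"
    using sigma_T_at_right[OF F \<mu>] exponent_at_right[OF F \<mu>]
    unfolding filterlim_at by (auto elim: eventually_mono)
  have "((\<lambda>s. (\<mu> * s - sigma_T FT F s) / s\<^sup>2
      + (sigma_T FT F s - sigma_B FB (sigma_T FT F s)) / (sigma_T FT F s)\<^sup>2 * (sigma_T FT F s / s)\<^sup>2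
      + laplace_remainder FA (exponent F s) * (exponent F s / s)\<^sup>2) \<longlongrightarrow>
      mean FT * ((\<integral>x. x\<^sup>2 \<partial>F) / 2) + mean FB / 2 * \<mu>\<^sup>2 + (\<integral>a. a\<^sup>2 \<partial>FA) / 2 * \<mu>\<^sup>2) (at_right 0)"
    by (intro tendsto_add tendsto_mult tendsto_power sigma_T_ratio[OF F] exponent_ratio[OF F \<mu>]
        filterlim_compose[OF sigma_B_second_order_limit[OF FB fin(4)] sigma_T_at_right[OF F \<mu>]]
        filterlim_compose[OF laplace_remainder_limit[OF FA fin(2,3)] exponent_at_right[OF F \<mu>]]
        sigma_T_second_order_limit[OF FT fin(1) F'(1,2,4), unfolded F'(3)])
  moreover have "eventually (\<lambda>s. (\<mu> * s - sigma_T FT F s) / s\<^sup>2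
      + (sigma_T FT F s - sigma_B FB (sigma_T FT F s)) / (sigma_T FT F s)\<^sup>2 * (sigma_T FT F s / s)\<^sup>2
      + laplace_remainder FA (exponent F s) * (exponent F s / s)\<^sup>2 = laplace_remainder F s) (at_right 0)"
    using pos eventually_at_right_less[of 0]
  proof eventually_elim
    case (elim s)
    then show ?case
      using second_order_decomposition[OF mean_FA, of s F \<mu>] eq[of s]
      by (simp add: laplace_remainder_def[of F] F'(3))
  qed
  ultimately have "(laplace_remainder F \<longlongrightarrow>
      mean FT * ((\<integral>x. x\<^sup>2 \<partial>F) / 2) + mean FB / 2 * \<mu>\<^sup>2 + (\<integral>a. a\<^sup>2 \<partial>FA) / 2 * \<mu>\<^sup>2) (at_right 0)"
    by (rule Lim_transform_eventually)
  with laplace_remainder_limit[OF F'(1,2,4)]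
  have "(\<integral>x. x\<^sup>2 \<partial>F) / 2 = mean FT * ((\<integral>x. x\<^sup>2 \<partial>F) / 2) + mean FB / 2 * \<mu>\<^sup>2 + (\<integral>a. a\<^sup>2 \<partial>FA) / 2 * \<mu>\<^sup>2"
    by (intro tendsto_unique[OF trivial_limit_at_right_real])
  then show ?thesis by (simp add: algebra_simps)
qed

text \<open>
  Since \<open>u(s) / s\<close> and \<open>(1 - L F s) / s\<close> have the same limit \<open>\<mu> > 0\<close>, the quotient
  \<open>(1 - L FA u) / u\<close> tends to \<open>1\<close>; it also tends to the mean of \<open>A\<close>, which is finite because these
  quotients are bounded.
\<close>

lemma mean_FA_of_solution:
  assumes \<mu>: "0 < \<mu>" and sol: "solution_with_mean FT FA FB \<mu> F"
  shows "mean_finite FA" "mean FA = 1"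
proof -
  note F = solution_with_meanD(1)[OF sol] and eq = solution_with_meanD(2)[OF sol]
  note F' = second_order_distributionD[OF F]
  have "eventually (\<lambda>s. \<mu> / 2 < exponent F s / s) (at_right 0)"
    by (rule order_tendstoD(1)[OF exponent_ratio[OF F \<mu>]]) (use \<mu> in simp)
  then obtain s where s: "\<And>n. 0 < s n" "\<And>n. \<mu> / 2 < exponent F (s n) / s n" and s_lim0: "s \<longlonglongrightarrow> 0"
    by (rule eventually_at_right_0_sequence) blast
  have s_lim: "filterlim s (at_right 0) sequentially"
    using s(1) s_lim0 by (auto simp: filterlim_at order_less_imp_not_eq2)
  have quot: "(1 - laplace_stieltjes FA (exponent F x)) / exponent F x 
      = ((1 - laplace_stieltjes F x) / x) / (exponent F x / x)" if "0 < x" for x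
    using that by (simp add: eq)
  have u: "0 < exponent F (s n)" for n
  proof -
    have "0 < exponent F (s n) / s n" using s(2)[of n] \<mu> by linarith
    then show ?thesis using s(1)[of n] by (simp add: zero_less_divide_iff)
  qed
  have u_lim: "(\<lambda>n. exponent F (s n)) \<longlonglongrightarrow> 0"
    using filterlim_compose[OF exponent_at_right[OF F \<mu>] s_lim] by (simp add: filterlim_at)
  show fin: "mean_finite FA"
  proof (rule mean_finite_if_bounded_difference_quotients[OF FA u u_lim])
    fix n
    have "(1 - laplace_stieltjes F (s n)) / s n \<le> \<mu>"
      using one_minus_laplace_le[OF F'(1,2), of "s n"] s(1)[of n] F'(3) by (simp add: pos_divide_le_eq)
    then have "((1 - laplace_stieltjes F (s n)) / s n) / (exponent F (s n) / s n) \<le> \<mu> / (\<mu> / 2)"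
      using \<mu> s(2)[of n] by (intro frac_le[of \<mu> _ "\<mu> / 2"]) simp_all
    then show "(1 - laplace_stieltjes FA (exponent F (s n))) / exponent F (s n) \<le> 2"
      unfolding quot[OF s(1)] using \<mu> by simp
  qed
  have "((\<lambda>x. (1 - laplace_stieltjes FA (exponent F x)) / exponent F x) \<longlongrightarrow> mean FA) (at_right 0)"
    by (rule filterlim_compose[OF laplace_first_order_limit[OF FA fin] exponent_at_right[OF F \<mu>]])
  moreover have "((\<lambda>x. ((1 - laplace_stieltjes F x) / x) / (exponent F x / x)) \<longlongrightarrow> \<mu> / \<mu>) (at_right 0)"
    using \<mu> laplace_first_order_limit[OF F'(1,2)] F'(3)
    by (intro tendsto_divide exponent_ratio[OF F \<mu>]) auto
  then have "((\<lambda>x. (1 - laplace_stieltjes FA (exponent F x)) / exponent F x) \<longlongrightarrow> \<mu> / \<mu>) (at_right 0)"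
    by (rule Lim_transform_eventually)
       (use eventually_at_right_less[of 0] in \<open>eventually_elim, simp add: quot\<close>)
  ultimately have "mean FA = \<mu> / \<mu>"
    by (intro tendsto_unique[OF trivial_limit_at_right_real])
  then show "mean FA = 1" using \<mu> by simp
qed

text \<open>
  All three summands of the decomposition are nonnegative, and their sum is at most \<open>E[X\<^sup>2] / 2\<close>.  So
  each is bounded, and the factors \<open>(\<sigma>(s) / s)\<^sup>2\<close> and \<open>(u(s) / s)\<^sup>2\<close> stay away from \<open>0\<close>.
\<close>

lemma moments_of_solution:
  assumes \<mu>: "0 < \<mu>" and sol: "solution_with_mean FT FA FB \<mu> F"
  shows "mean_finite FT" "integrable FA (\<lambda>a. a\<^sup>2)" "mean_finite FB"
proof -
  note F = solution_with_meanD(1)[OF sol] and eq = solution_with_meanD(2)[OF sol]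
  note F' = second_order_distributionD[OF F]
  note A = mean_FA_of_solution[OF \<mu> sol]
  define M where "M = (\<integral>x. x\<^sup>2 \<partial>F)"
  have "0 < M"
    using mean_power2_le_second_moment[OF F'(1,2,4)] \<mu> F'(3) unfolding M_def
    by (metis less_le_trans zero_less_power)
  have "eventually (\<lambda>s. \<mu> / 2 < exponent F s / s) (at_right 0)"
    by (rule order_tendstoD(1)[OF exponent_ratio[OF F \<mu>]]) (use \<mu> in simp)
  then obtain s where s: "\<And>n. 0 < s n" "\<And>n. \<mu> / 2 < exponent F (s n) / s n" and s_lim0: "s \<longlonglongrightarrow> 0"
    by (rule eventually_at_right_0_sequence) blast
  have s_lim: "filterlim s (at_right 0) sequentially"
    using s(1) s_lim0 by (auto simp: filterlim_at order_less_imp_not_eq2)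
  have u: "0 < exponent F (s n)" "exponent F (s n) \<le> sigma_T FT F (s n)" "0 < sigma_T FT F (s n)"
    "\<mu> / 2 \<le> exponent F (s n) / s n" "\<mu> / 2 \<le> sigma_T FT F (s n) / s n" for n
  proof -
    show a: "\<mu> / 2 \<le> exponent F (s n) / s n" using s(2)[of n] by simp
    have "0 < exponent F (s n) / s n" using a \<mu> by linarith
    then show b: "0 < exponent F (s n)" using s(1)[of n] by (simp add: zero_less_divide_iff)
    show c: "exponent F (s n) \<le> sigma_T FT F (s n)"
      using exponent_bounds(2)[OF F, of "s n"] s(1)[of n] by simp
    show "0 < sigma_T FT F (s n)" using b c by linarith
    have "exponent F (s n) / s n \<le> sigma_T FT F (s n) / s n"
      using c s(1)[of n] by (simp add: divide_right_mono)
    with a show "\<mu> / 2 \<le> sigma_T FT F (s n) / s n" by linarith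
  qed
  have u_lim: "(\<lambda>n. exponent F (s n)) \<longlonglongrightarrow> 0" "(\<lambda>n. sigma_T FT F (s n)) \<longlonglongrightarrow> 0"
    using filterlim_compose[OF exponent_at_right[OF F \<mu>] s_lim]
      filterlim_compose[OF sigma_T_at_right[OF F \<mu>] s_lim] by (simp_all add: filterlim_at)
  define t1 where "t1 n = (\<mu> * s n - sigma_T FT F (s n)) / (s n)\<^sup>2" for n
  define t2 where "t2 n = (sigma_T FT F (s n) - sigma_B FB (sigma_T FT F (s n))) / (sigma_T FT F (s n))\<^sup>2" for n
  define t3 where "t3 n = laplace_remainder FA (exponent F (s n))" for n
  have nonneg: "0 \<le> t1 n" "0 \<le> t2 n" "0 \<le> t3 n" for n
  proof -
    show "0 \<le> t1 n" using exponent_bounds(3)[OF F, of "s n"] s(1)[of n] by (simp add: t1_def)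
    show "0 \<le> t2 n" using sigma_B_le[OF FB, of "sigma_T FT F (s n)"] u(3)[of n] by (simp add: t2_def)
    show "0 \<le> t3 n" unfolding t3_def by (rule laplace_remainder_nonneg[OF FA A(1) u(1)])
  qed
  have total: "t1 n + t2 n * (sigma_T FT F (s n) / s n)\<^sup>2 + t3 n * (exponent F (s n) / s n)\<^sup>2 \<le> M / 2" for n
  proof -
    have "t1 n + t2 n * (sigma_T FT F (s n) / s n)\<^sup>2 + t3 n * (exponent F (s n) / s n)\<^sup>2 = laplace_remainder F (s n)"
      using second_order_decomposition[OF A(2) s(1), of F n \<mu>] u(1,3)[of n] s(1)[of n] eq[of "s n"]
      by (simp add: t1_def t2_def t3_def laplace_remainder_def[of F] F'(3))
    also have "\<dots> \<le> M / 2"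
      unfolding M_def by (rule laplace_remainder_le[OF F'(1,2,4) s(1)])
    finally show ?thesis .
  qed
  define c where "c = (\<mu> / 2)\<^sup>2"
  have "0 < c" using \<mu> by (simp add: c_def)
  have c: "c \<le> (sigma_T FT F (s n) / s n)\<^sup>2" "c \<le> (exponent F (s n) / s n)\<^sup>2" for n
    unfolding c_def using u(4,5)[of n] \<mu> by (auto intro!: power_mono)
  have le: "t1 n \<le> M / 2" "t2 n * c \<le> M / 2" "t3 n * c \<le> M / 2" for n
  proof -
    have "t2 n * c \<le> t2 n * (sigma_T FT F (s n) / s n)\<^sup>2" "t3 n * c \<le> t3 n * (exponent F (s n) / s n)\<^sup>2"
      by (intro mult_left_mono c nonneg)+
    moreover have "0 \<le> t2 n * c" "0 \<le> t3 n * c" using nonneg \<open>0 < c\<close> by auto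
    ultimately show "t1 n \<le> M / 2" "t2 n * c \<le> M / 2" "t3 n * c \<le> M / 2"
      using total[of n] nonneg[of n] by linarith+
  qed
  have quot: "t2 n \<le> M / 2 / c" "t3 n \<le> M / 2 / c" for n
    using le(2,3)[of n] by (simp_all only: pos_le_divide_eq[OF \<open>0 < c\<close>])
  show "mean_finite FT"
    by (rule mean_finite_if_bounded_sigma_T_second_order[OF FT F'(1,2,4) _ s(1) s_lim0, where K = "M / 2"])
       (use le(1) \<open>0 < M\<close> F'(3) in \<open>auto simp: M_def t1_def\<close>)
  show "mean_finite FB"
    by (rule mean_finite_if_bounded_sigma_B_second_order[OF FB u(3) u_lim(2), where K = "M / 2 / c"])
       (rule quot(1)[unfolded t2_def])
  show "integrable FA (\<lambda>a. a\<^sup>2)"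
    by (rule second_moment_finite_if_bounded_remainders[OF FA A(1) u(1) u_lim(1), where K = "M / 2 / c"])
       (rule quot(2)[unfolded t3_def])
qed

text \<open>
  Iterating the contraction \<open>n\<close> times bounds the difference of the transforms by \<open>E[T]^n K s\<^sup>2\<close>.
\<close>

lemma solution_unique:
  assumes fin: "mean_finite FT" "mean FT < 1" "mean_finite FA" "mean FA = 1"
    and solF: "solution_with_mean FT FA FB \<mu> F" and solG: "solution_with_mean FT FA FB \<mu> G"
  shows "F = G"
proof (rule laplace_stieltjes_unique)
  note F = solution_with_meanD(1)[OF solF] and eqF = solution_with_meanD(2)[OF solF]
  note G = solution_with_meanD(1)[OF solG] and eqG = solution_with_meanD(2)[OF solG]
  show "nonneg_distribution F" "nonneg_distribution G"
    by (rule second_order_distributionD(1)[OF F], rule second_order_distributionD(1)[OF G])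
  define K where "K = (\<integral>x. x\<^sup>2 \<partial>F) / 2 + (\<integral>x. x\<^sup>2 \<partial>G) / 2"
  have bound: "\<bar>laplace_stieltjes F s - laplace_stieltjes G s\<bar> \<le> (mean FT ^ n * K) * s\<^sup>2" if "0 \<le> s" for n s
    using that
  proof (induction n arbitrary: s)
    case 0
    have "(\<integral>x. x\<^sup>2 \<partial>F) / 2 * s\<^sup>2 + (\<integral>x. x\<^sup>2 \<partial>G) / 2 * s\<^sup>2 = K * s\<^sup>2"
      by (simp add: K_def distrib_right)
    then show ?case
      using second_order_distribution_expansion[OF F 0] second_order_distribution_expansion[OF G 0]
      unfolding power_0 mult_1 abs_le_iff by linarith
  next
    case (Suc n)
    have "\<bar>laplace_stieltjes F s - laplace_stieltjes G s\<bar> \<le> mean FT * (mean FT ^ n * K) * s\<^sup>2"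
      unfolding eqF[OF Suc.prems] eqG[OF Suc.prems]
      by (rule exponent_contraction[OF fin(1,3,4) F G Suc.prems Suc.IH])
    then show ?case by (simp only: power_Suc mult.assoc)
  qed
  show "laplace_stieltjes F s = laplace_stieltjes G s" if "0 \<le> s" for s
  proof -
    have "(\<lambda>n. mean FT ^ n * K * s\<^sup>2) \<longlonglongrightarrow> 0 * K * s\<^sup>2"
      using fin(2) mean_nonneg[OF FT] by (intro tendsto_intros LIMSEQ_realpow_zero)
    then have "\<bar>laplace_stieltjes F s - laplace_stieltjes G s\<bar> \<le> 0 * K * s\<^sup>2"
      using bound[OF that] by (intro LIMSEQ_le_const) auto
    then show ?thesis by simp
  qed
qed

text \<open>
  One step of the iteration.  The right side is a transform by subordination, and each of the
  three parts of its second order expansion is at most a constant times \<open>s\<^sup>2\<close>, so that mean and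
  finite second moment are preserved.
\<close>

lemma solution_operator:
  assumes fin: "mean_finite FT" "mean_finite FA" "integrable FA (\<lambda>a. a\<^sup>2)" "mean_finite FB"
    and mean_FA: "mean FA = 1" and F: "second_order_distribution \<mu> F"
  shows "\<exists>G. second_order_distribution \<mu> G \<and>
      (\<forall>s\<ge>0. laplace_stieltjes G s = laplace_stieltjes FA (exponent F s))"
proof -
  note F' = second_order_distributionD[OF F]
  have A: "second_order_distribution 1 FA"
    using fin FA mean_FA by (simp add: second_order_distribution_def)
  have "laplace_exponent (exponent F)"
    unfolding exponent_def[abs_def]
    by (rule laplace_exponent_compose[OF laplace_exponent_sigma_B[OF FB] laplace_exponent_sigma_T[OF FT F'(1,2)]
          sigma_T_nonneg[OF FT F'(1)]])
  from is_laplace_compose[OF FA this] obtain G where G: "nonneg_distribution G"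
    and L: "\<And>s. 0 \<le> s \<Longrightarrow> laplace_stieltjes G s = laplace_stieltjes FA (exponent F s)"
    by (auto simp: is_laplace_def)
  define M where "M = (\<integral>x. x\<^sup>2 \<partial>F) / 2"
  define N where "N = (\<integral>a. a\<^sup>2 \<partial>FA) / 2"
  have "second_order_distribution \<mu> G"
  proof (rule second_order_distributionI_expansion[OF G])
    fix s :: real assume s: "0 < s"
    define \<sigma> where "\<sigma> = sigma_T FT F s"
    define u where "u = exponent F s"
    note b = exponent_bounds[OF F less_imp_le[OF s], folded \<sigma>_def u_def]
    have "0 \<le> N" unfolding N_def by simp
    have sq: "\<sigma>\<^sup>2 \<le> \<mu>\<^sup>2 * s\<^sup>2" "u\<^sup>2 \<le> \<mu>\<^sup>2 * s\<^sup>2"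
      unfolding power_mult_distrib[symmetric] using b by (auto intro!: power_mono)
    have 1: "\<mu> * s - \<sigma> \<le> mean FT * M * s\<^sup>2"
      using sigma_T_second_order_le[OF FT fin(1) F'(1,2,4) s] s
      by (simp add: F'(3) \<sigma>_def[symmetric] M_def[symmetric] pos_divide_le_eq)
    have 2: "\<sigma> - u \<le> mean FB / 2 * \<mu>\<^sup>2 * s\<^sup>2"
    proof -
      have "\<sigma> - u \<le> mean FB / 2 * \<sigma>\<^sup>2"
      proof (cases "\<sigma> = 0")
        case False
        with b have "0 < \<sigma>" by linarith
        with sigma_B_second_order_le[OF FB fin(4) this] show ?thesis
          by (simp add: u_def exponent_def \<sigma>_def[symmetric] pos_divide_le_eq)
      qed (use b in simp)
      also have "\<dots> \<le> mean FB / 2 * (\<mu>\<^sup>2 * s\<^sup>2)"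
        using mean_nonneg[OF FB] sq by (intro mult_left_mono) auto
      finally show ?thesis by (simp add: mult.assoc)
    qed
    have 3: "0 \<le> laplace_stieltjes FA u - 1 + u" "laplace_stieltjes FA u - 1 + u \<le> N * \<mu>\<^sup>2 * s\<^sup>2"
    proof -
      show "0 \<le> laplace_stieltjes FA u - 1 + u"
        using second_order_distribution_expansion(1)[OF A b(1)] by simp
      have "laplace_stieltjes FA u - 1 + u \<le> N * u\<^sup>2"
        using second_order_distribution_expansion(2)[OF A b(1)] by (simp add: N_def)
      also have "\<dots> \<le> N * (\<mu>\<^sup>2 * s\<^sup>2)"
        using \<open>0 \<le> N\<close> sq by (intro mult_left_mono) auto
      finally show "laplace_stieltjes FA u - 1 + u \<le> N * \<mu>\<^sup>2 * s\<^sup>2" by (simp add: mult.assoc)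
    qed
    have "\<bar>laplace_stieltjes FA u - 1 + \<mu> * s\<bar>
        \<le> mean FT * M * s\<^sup>2 + mean FB / 2 * \<mu>\<^sup>2 * s\<^sup>2 + N * \<mu>\<^sup>2 * s\<^sup>2"
      using 1 2 3 b by linarith
    then show "\<bar>laplace_stieltjes G s - 1 + \<mu> * s\<bar> \<le> (mean FT * M + mean FB / 2 * \<mu>\<^sup>2 + N * \<mu>\<^sup>2) * s\<^sup>2"
      by (simp only: L[OF less_imp_le[OF s]] u_def[symmetric] distrib_right)
  qed
  with L show ?thesis by blast
qed

text \<open>
  The iterates started at the unit mass at \<open>\<mu>\<close> satisfy geometric bounds \<open>r^n K s\<^sup>2\<close> with \<open>r = E[T]\<close>, so their
  transforms converge, and the limit \<open>\<phi>\<close> differs from the first one by \<open>O(s\<^sup>2)\<close>.  That keeps \<open>\<phi>\<close> continuous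
  at \<open>0\<close>, keeps the mean and gives a finite second moment.
\<close>

lemma solution_exists:
  assumes \<mu>: "0 < \<mu>"
    and fin: "mean_finite FT" "mean_finite FA" "integrable FA (\<lambda>a. a\<^sup>2)" "mean_finite FB"
    and mean_FT: "mean FT < 1" and mean_FA: "mean FA = 1"
  shows "\<exists>F. solution_with_mean FT FA FB \<mu> F"
proof -
  define r where "r = mean FT"
  have r: "0 \<le> r" "r < 1" using mean_nonneg[OF FT] mean_FT by (simp_all add: r_def)
  obtain \<Phi> where \<Phi>: "\<And>F. second_order_distribution \<mu> F \<Longrightarrow> second_order_distribution \<mu> (\<Phi> F)"
    and L\<Phi>: "\<And>F s. second_order_distribution \<mu> F \<Longrightarrow> 0 \<le> s \<Longrightarrow>
      laplace_stieltjes (\<Phi> F) s = laplace_stieltjes FA (exponent F s)"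
    using solution_operator[OF fin mean_FA] by metis
  define F where "F n = (\<Phi> ^^ n) (return borel \<mu>)" for n
  have F: "second_order_distribution \<mu> (F n)" for n
    by (induction n) (use \<mu> in \<open>simp_all add: F_def \<Phi> second_order_distribution_return\<close>)
  have L_Suc: "laplace_stieltjes (F (Suc n)) s = laplace_stieltjes FA (exponent (F n) s)" if "0 \<le> s" for n s
    using L\<Phi>[OF F that, of n] by (simp add: F_def)
  define K where "K = (\<integral>x. x\<^sup>2 \<partial>F 1) / 2 + (\<integral>x. x\<^sup>2 \<partial>F 0) / 2"
  have step: "\<bar>laplace_stieltjes (F (Suc n)) s - laplace_stieltjes (F n) s\<bar> \<le> (r ^ n * K) * s\<^sup>2"
    if "0 \<le> s" for n s
    using that
  proof (induction n arbitrary: s)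
    case 0
    have "(\<integral>x. x\<^sup>2 \<partial>F 1) / 2 * s\<^sup>2 + (\<integral>x. x\<^sup>2 \<partial>F 0) / 2 * s\<^sup>2 = K * s\<^sup>2"
      by (simp add: K_def distrib_right)
    then show ?case
      using second_order_distribution_expansion[OF F[of 1] 0] second_order_distribution_expansion[OF F[of 0] 0]
      unfolding power_0 mult_1 abs_le_iff One_nat_def by linarith
  next
    case (Suc n)
    have "\<bar>laplace_stieltjes (F (Suc (Suc n))) s - laplace_stieltjes (F (Suc n)) s\<bar> \<le> r * (r ^ n * K) * s\<^sup>2"
      unfolding L_Suc[OF Suc.prems] r_def
      by (rule exponent_contraction[OF fin(1,2) mean_FA F F Suc.prems]) (use Suc.IH in \<open>simp add: r_def\<close>)
    then show ?case by (simp only: power_Suc mult.assoc)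
  qed
  (* The sum of the geometric series of the step bounds. *)
  define C where "C = K / (1 - r)"
  have C: "C * r + K = C" using r by (simp add: C_def field_simps)
  have dist: "\<bar>laplace_stieltjes (F (n + k)) s - laplace_stieltjes (F n) s\<bar> \<le> (r ^ n * C) * s\<^sup>2"
    if "0 \<le> s" for n k s
  proof (induction k arbitrary: n)
    case 0
    have "0 \<le> K" by (simp add: K_def)
    then show ?case using r by (simp add: C_def)
  next
    case (Suc k)
    have "\<bar>laplace_stieltjes (F (n + Suc k)) s - laplace_stieltjes (F n) s\<bar>
        \<le> (r ^ Suc n * C) * s\<^sup>2 + (r ^ n * K) * s\<^sup>2"
      using Suc[of "Suc n"] step[OF that, of n] by simp
    also have "\<dots> = (r ^ n * (C * r + K)) * s\<^sup>2" by (simp add: algebra_simps)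
    finally show ?case by (simp only: C)
  qed
  have geometric: "(\<lambda>n. r ^ n * c * s\<^sup>2) \<longlonglongrightarrow> 0" for c s
  proof -
    have "(\<lambda>n. r ^ n * c * s\<^sup>2) \<longlonglongrightarrow> 0 * c * s\<^sup>2"
      using r by (intro tendsto_intros LIMSEQ_realpow_zero)
    then show ?thesis by simp
  qed
  have "convergent (\<lambda>n. laplace_stieltjes (F n) s)" if "0 \<le> s" for s
  proof (rule real_Cauchy_convergent, rule metric_CauchyI)
    fix e :: real assume "0 < e"
    then obtain N where N: "\<And>n. N \<le> n \<Longrightarrow> r ^ n * C * s\<^sup>2 < e / 2"
      using order_tendstoD(2)[OF geometric[of C s], of "e / 2"] by (auto simp: eventually_sequentially)
    have *: "\<bar>laplace_stieltjes (F n) s - laplace_stieltjes (F N) s\<bar> < e / 2" if "N \<le> n" for n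
      using dist[OF \<open>0 \<le> s\<close>, of N "n - N"] N[of N] that by simp
    have "dist (laplace_stieltjes (F m) s) (laplace_stieltjes (F n) s) < e" if "N \<le> m" "N \<le> n" for m n
      using *[OF that(1)] *[OF that(2)] unfolding dist_real_def by linarith
    then show "\<exists>M. \<forall>m\<ge>M. \<forall>n\<ge>M. dist (laplace_stieltjes (F m) s) (laplace_stieltjes (F n) s) < e"
      by blast
  qed
  then obtain \<phi> where \<phi>: "\<And>s. 0 \<le> s \<Longrightarrow> (\<lambda>n. laplace_stieltjes (F n) s) \<longlonglongrightarrow> \<phi> s"
    unfolding convergent_def by metis
  have close: "\<bar>\<phi> s - laplace_stieltjes (F n) s\<bar> \<le> (r ^ n * C) * s\<^sup>2" if "0 \<le> s" for n s
  proof (rule LIMSEQ_le_const2)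
    show "(\<lambda>k. \<bar>laplace_stieltjes (F (n + k)) s - laplace_stieltjes (F n) s\<bar>) \<longlonglongrightarrow> \<bar>\<phi> s - laplace_stieltjes (F n) s\<bar>"
      using LIMSEQ_ignore_initial_segment[OF \<phi>[OF that], of n] by (intro tendsto_intros) (simp add: add.commute)
  qed (use dist[OF that] in auto)
  have expansion: "\<bar>\<phi> s - 1 + \<mu> * s\<bar> \<le> (C + (\<integral>x. x\<^sup>2 \<partial>F 0) / 2) * s\<^sup>2" if "0 \<le> s" for s
    using close[OF that, of 0] second_order_distribution_expansion[OF F[of 0] that]
    unfolding distrib_right power_0 mult_1 by linarith
  have "is_laplace \<phi>"
  proof (rule laplace_continuity_theorem)
    show "is_laplace (laplace_stieltjes (F n))" for n
      using second_order_distributionD(1)[OF F] by (rule is_laplaceI)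
    have "((\<lambda>s. \<phi> s - 1 + \<mu> * s) \<longlongrightarrow> 0) (at_right 0)"
    proof (rule Lim_null_comparison)
      show "eventually (\<lambda>s. norm (\<phi> s - 1 + \<mu> * s) \<le> (C + (\<integral>x. x\<^sup>2 \<partial>F 0) / 2) * s\<^sup>2) (at_right 0)"
        using eventually_at_right_less[of 0] by eventually_elim (simp only: real_norm_def expansion less_imp_le)
      have "((\<lambda>s. (C + (\<integral>x. x\<^sup>2 \<partial>F 0) / 2) * s\<^sup>2) \<longlongrightarrow> (C + (\<integral>x. x\<^sup>2 \<partial>F 0) / 2) * 0\<^sup>2) (at_right 0)"
        by (intro tendsto_intros)
      then show "((\<lambda>s. (C + (\<integral>x. x\<^sup>2 \<partial>F 0) / 2) * s\<^sup>2) \<longlongrightarrow> 0) (at_right 0)" by simp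
    qed
    then have "((\<lambda>s. (\<phi> s - 1 + \<mu> * s) + 1 - \<mu> * s) \<longlongrightarrow> 0 + 1 - \<mu> * 0) (at_right 0)"
      by (intro tendsto_intros)
    then show "(\<phi> \<longlongrightarrow> 1) (at_right 0)" by simp
  qed (rule \<phi>)
  then obtain G where G: "nonneg_distribution G" and LG: "\<And>s. 0 \<le> s \<Longrightarrow> laplace_stieltjes G s = \<phi> s"
    by (auto simp: is_laplace_def)
  have G': "second_order_distribution \<mu> G"
    by (rule second_order_distributionI_expansion[OF G, where C = "C + (\<integral>x. x\<^sup>2 \<partial>F 0) / 2"])
       (use expansion LG in simp)
  have "laplace_stieltjes G s = laplace_stieltjes FA (exponent G s)" if s: "0 \<le> s" for s
  proof (rule LIMSEQ_unique)
    show "(\<lambda>n. laplace_stieltjes (F (Suc n)) s) \<longlonglongrightarrow> laplace_stieltjes G s"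
      unfolding LG[OF s] by (rule LIMSEQ_Suc[OF \<phi>[OF s]])
    have "(\<lambda>n. laplace_stieltjes (F (Suc n)) s - laplace_stieltjes FA (exponent G s)) \<longlonglongrightarrow> 0"
    proof (rule Lim_null_comparison)
      have "\<bar>laplace_stieltjes (F (Suc n)) s - laplace_stieltjes FA (exponent G s)\<bar> \<le> r * (r ^ n * C) * s\<^sup>2" for n
        unfolding L_Suc[OF s] r_def
        by (rule exponent_contraction[OF fin(1,2) mean_FA F G' s])
           (use close LG in \<open>simp add: r_def abs_minus_commute\<close>)
      then show "eventually (\<lambda>n. norm (laplace_stieltjes (F (Suc n)) s - laplace_stieltjes FA (exponent G s))
          \<le> r ^ n * (r * C) * s\<^sup>2) sequentially"
        by (simp add: mult_ac)
      show "(\<lambda>n. r ^ n * (r * C) * s\<^sup>2) \<longlonglongrightarrow> 0" by (rule geometric)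
    qed
    then show "(\<lambda>n. laplace_stieltjes (F (Suc n)) s) \<longlonglongrightarrow> laplace_stieltjes FA (exponent G s)"
      by (rule LIM_zero_cancel)
  qed
  with G' show ?thesis unfolding solution_with_mean_iff by blast
qed

end

section \<open>The characterization\<close>

theorem theorem1:
  fixes FT FA FB :: "real measure" and \<mu> :: real
  assumes "0 < \<mu>"
    and "nonneg_distribution FT"
    and "nonneg_distribution FA"
    and "nonneg_distribution FB"
  shows
    "(((mean_finite FT \<and> 0 \<le> mean FT \<and> mean FT < 1) \<and>
       (mean_finite FA \<and> mean FA = 1) \<and>
       integrable FA (\<lambda>a. a\<^sup>2) \<and>
       (mean_finite FB \<and> 0 \<le> mean FB))
      \<longleftrightarrow> (\<exists>!F. solution_with_mean FT FA FB \<mu> F))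
     \<and>
     ((mean_finite FT \<and> 0 \<le> mean FT \<and> mean FT < 1) \<and>
      (mean_finite FA \<and> mean FA = 1) \<and>
      integrable FA (\<lambda>a. a\<^sup>2) \<and>
      (mean_finite FB \<and> 0 \<le> mean FB)
      \<longrightarrow> (\<forall>F. solution_with_mean FT FA FB \<mu> F \<longrightarrow>
             var F = (var FA + mean FB + mean FT) / (1 - mean FT) * \<mu>\<^sup>2))"
    (is "(?cond \<longleftrightarrow> (\<exists>!F. ?sol F)) \<and> (?cond \<longrightarrow> _)")
proof -
  interpret functional_equation FT FA FB by unfold_locales (use assms in auto)
  have unique: "\<exists>!F. ?sol F" if c: ?cond
  proof -
    have "\<exists>F. ?sol F"
      using c assms(1) by (intro solution_exists) auto
    moreover have "F = G" if "?sol F" "?sol G" for F G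
      using c by (intro solution_unique[OF _ _ _ _ that]) auto
    ultimately show ?thesis by blast
  qed
  have necessary: ?cond if "\<exists>!F. ?sol F"
  proof -
    from that obtain F where sol: "?sol F" by blast
    note A = mean_FA_of_solution[OF assms(1) sol] and fin = moments_of_solution[OF assms(1) sol]
    (* E[A] = 1 keeps the right side of the second moment equation positive. *)
    have "1 \<le> (\<integral>a. a\<^sup>2 \<partial>FA)"
      using mean_power2_le_second_moment[OF FA A(1) fin(2)] A(2) by simp
    then have "0 < ((\<integral>a. a\<^sup>2 \<partial>FA) + mean FB) * \<mu>\<^sup>2"
      using mean_nonneg[OF FB] assms(1) by (intro mult_pos_pos) auto
    then have "0 < (1 - mean FT) * (\<integral>x. x\<^sup>2 \<partial>F)"
      using second_moment_equation[OF assms(1) sol fin(1) A(1) fin(2,3) A(2)] by linarith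
    moreover have "0 \<le> (\<integral>x. x\<^sup>2 \<partial>F)" by simp
    ultimately have "mean FT < 1"
      by (auto simp: zero_less_mult_iff)
    with A fin mean_nonneg[OF FT] mean_nonneg[OF FB] show ?cond by simp
  qed
  have "var F = (var FA + mean FB + mean FT) / (1 - mean FT) * \<mu>\<^sup>2" if c: ?cond and sol: "?sol F" for F
  proof -
    note F' = second_order_distributionD[OF solution_with_meanD(1)[OF sol]]
    have "(1 - mean FT) * (\<integral>x. x\<^sup>2 \<partial>F) = ((\<integral>a. a\<^sup>2 \<partial>FA) + mean FB) * \<mu>\<^sup>2"
      using c by (intro second_moment_equation[OF assms(1) sol]) auto
    moreover have "var F = (\<integral>x. x\<^sup>2 \<partial>F) - \<mu>\<^sup>2"
      using second_moment_eq_variance(2)[OF F'(1,2,4)] F'(3) by simp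
    moreover have "var FA = (\<integral>a. a\<^sup>2 \<partial>FA) - 1"
      using second_moment_eq_variance(2)[OF FA] c by simp
    moreover have "1 - mean FT \<noteq> 0" using c by simp
    ultimately have "(1 - mean FT) * var F = (var FA + mean FB + mean FT) * \<mu>\<^sup>2"
      by (simp only: right_diff_distrib distrib_right left_diff_distrib mult_1)
    then show ?thesis using \<open>1 - mean FT \<noteq> 0\<close> by (simp add: field_simps)
  qed
  with unique necessary show ?thesis by blast
qed

end
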